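(* Let $n\ge1$, $k\ge0$, $\mu_0=k(n-1)$, $\nu\in\mathbb{C}$ with $\Re\nu>\mu_0+\tfrac12$ and $k'=\nu-\mu_0-\tfrac12$. Let $f\in C^\infty(\mathbb{R}^n)$ be $\mathbb{Z}_2^n$-invariant. Then (i) there exists $f_0\in C^\infty(\mathbb{R}^n)$ with $f(x)=f_0(x^2)$ for all $x\in\mathbb{R}^n$; (ii) for all $x\in\mathbb{R}^n$ with $x_1\cdots x_n\neq0$, \[ \Delta(T^B)^2f(x)=(\mathscr{L}_\nu f_0)(x^2),\qquad \mathscr{L}_\nu=4^n\,\Delta(x)^{1+\mu_0-\nu}\,\Delta(T^A)\,\Delta(x)^{\nu-\mu_0}\,\Delta(T^A), \] where the powers of $\Delta(x)$ act as multiplication operators (on $]0,\infty[^n$).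
   Context: Squares componentwise; $\mathbb{Z}_2^n$ acts by sign changes of coordinates; $\Delta(x)=x_1\cdots x_n$. Type $A$ Dunkl operators $T_i^Af(x)=\partial_if(x)+k\sum_{j\ne i}\frac{f(x)-f(s_{ij}x)}{x_i-x_j}$, $\Delta(T^A)=T^A_1\cdots T^A_n$. Type $B$ Dunkl operators with multiplicity $k$ on $\pm e_i\pm e_j$ and $k'$ on $\pm e_i$: $T^B_i f(x)=\partial_i f(x)+k'\frac{f(x)-f(\sigma_i x)}{x_i}+k\sum_{j\neq i}\Big(\frac{f(x)-f(s_{ij}x)}{x_i-x_j}+\frac{f(x)-f(\tau_{ij}x)}{x_i+x_j}\Big)$ ($\sigma_i$: sign change of coordinate $i$; $s_{ij}$: swap of coordinates $i,j$; $\tau_{ij}$: swap and negation of both). These commute, and $\Delta(T^B)^2=(T_1^B\cdots T_n^B)^2$. *)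

theory Defs
  imports "HOL-Analysis.Analysis"
begin

definition partial :: "'n::finite \<Rightarrow> (real ^ 'n \<Rightarrow> complex) \<Rightarrow> real ^ 'n \<Rightarrow> complex" where
  "partial i g x = vector_derivative (\<lambda>t. g (x + t *\<^sub>R axis i 1)) (at 0)"

text \<open>C^infinity functions on R^n: differentiable everywhere, and every partial
  derivative is again C^infinity (all partial derivatives of all orders exist and are
  continuous).\<close>
coinductive smooth :: "(real ^ 'n::finite \<Rightarrow> complex) \<Rightarrow> bool" where
  "(\<And>x. g differentiable (at x)) \<Longrightarrow> (\<And>i. smooth (partial i g)) \<Longrightarrow> smooth g"

definition sqv :: "real ^ 'n::finite \<Rightarrow> real ^ 'n" where
  "sqv x = (\<chi> i. (x $ i)^2)"

definition Delta :: "real ^ 'n::finite \<Rightarrow> real" where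
  "Delta x = (\<Prod>i\<in>UNIV. x $ i)"

definition sign_change :: "'n set \<Rightarrow> real ^ 'n::finite \<Rightarrow> real ^ 'n" where
  "sign_change S x = (\<chi> i. if i \<in> S then - (x $ i) else x $ i)"

definition Z2n_invariant :: "(real ^ 'n::finite \<Rightarrow> 'a) \<Rightarrow> bool" where
  "Z2n_invariant f \<longleftrightarrow> (\<forall>S x. f (sign_change S x) = f x)"

definition swapv :: "'n::finite \<Rightarrow> 'n \<Rightarrow> real ^ 'n \<Rightarrow> real ^ 'n" where
  "swapv i j x = (\<chi> l. x $ (Transposition.transpose i j l))"

definition tauv :: "'n::finite \<Rightarrow> 'n \<Rightarrow> real ^ 'n \<Rightarrow> real ^ 'n" where
  "tauv i j x = (\<chi> l. if l = i then - (x $ j) else if l = j then - (x $ i) else x $ l)"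

text \<open>Difference quotient \<open>(g(x) - g(\<sigma> x)) / l(x)\<close> of a reflection \<open>\<sigma>\<close> with
  root functional l, extended by continuity to the reflecting hyperplane \<open>l(x) = 0\<close>
  (for smooth g this limit exists).\<close>
definition dquot :: "(real ^ 'n::finite \<Rightarrow> real) \<Rightarrow> (real ^ 'n \<Rightarrow> real ^ 'n)
    \<Rightarrow> (real ^ 'n \<Rightarrow> complex) \<Rightarrow> real ^ 'n \<Rightarrow> complex" where
  "dquot l \<sigma> g x =
     (let q = (\<lambda>y. (g y - g (\<sigma> y)) / complex_of_real (l y)) in
      if l x \<noteq> 0 then q x else Lim (at x within {y. l y \<noteq> 0}) q)"

definition dunklA :: "real \<Rightarrow> 'n::finite \<Rightarrow> (real ^ 'n \<Rightarrow> complex) \<Rightarrow> real ^ 'n \<Rightarrow> complex" where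
  "dunklA k i g x = partial i g x
     + complex_of_real k * (\<Sum>j\<in>UNIV - {i}. dquot (\<lambda>y. y $ i - y $ j) (swapv i j) g x)"

definition dunklB :: "real \<Rightarrow> complex \<Rightarrow> 'n::finite \<Rightarrow> (real ^ 'n \<Rightarrow> complex) \<Rightarrow> real ^ 'n \<Rightarrow> complex" where
  "dunklB k k' i g x = partial i g x
     + k' * dquot (\<lambda>y. y $ i) (sign_change {i}) g x
     + complex_of_real k * (\<Sum>j\<in>UNIV - {i}.
          dquot (\<lambda>y. y $ i - y $ j) (swapv i j) g x
        + dquot (\<lambda>y. y $ i + y $ j) (tauv i j) g x)"

definition DeltaOp :: "('n::{finite,linorder} \<Rightarrow> 'a \<Rightarrow> 'a) \<Rightarrow> 'a \<Rightarrow> 'a" where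
  "DeltaOp T g = foldr T (sorted_list_of_set (UNIV :: 'n set)) g"

definition dimv :: "real ^ 'n::finite \<Rightarrow> nat" where
  "dimv x = CARD('n)"

text \<open>Multiplication by \<open>\<Delta>(x)^a\<close> (meaningful on \<open>]0,\<infinity>[^n\<close>).\<close>
definition Delta_pow_mult :: "complex \<Rightarrow> (real ^ 'n::finite \<Rightarrow> complex) \<Rightarrow> real ^ 'n \<Rightarrow> complex" where
  "Delta_pow_mult a g x = complex_of_real (Delta x) powr a * g x"

definition L_op :: "real \<Rightarrow> complex \<Rightarrow> (real ^ 'n::{finite,linorder} \<Rightarrow> complex) \<Rightarrow> real ^ 'n::{finite,linorder} \<Rightarrow> complex" where
  "L_op k \<nu> g x =
     (let \<mu>0 = complex_of_real (k * (real (dimv x) - 1)) in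
      4 ^ dimv x *
      Delta_pow_mult (1 + \<mu>0 - \<nu>)
        (DeltaOp (dunklA k) (Delta_pow_mult (\<nu> - \<mu>0) (DeltaOp (dunklA k) g))) x)"

end

theory Submission
  imports Defs
begin

text \<open>Part (i) is Whitney's theorem on even functions, proved one coordinate at a time. If \<open>f\<close> is even in
  \<open>x\<^sub>i\<close>, then \<open>f(\<surd>s)\<close> is smooth up to \<open>s = 0\<close>, because its \<open>s\<close>-derivative is \<open>(E f)(\<surd>s)\<close> with \<open>E f = \<partial>\<^sub>i f / (2 x\<^sub>i)\<close>
  again smooth and even. It is continued to \<open>s < 0\<close> by a Seeley-type series \<open>\<Sum>\<^sub>k c\<^sub>k F(2\<^sup>k \<surd>(-s))\<close>, where \<open>F\<close> is a
  cut-off of \<open>f\<close>; the condition \<open>\<Sum>\<^sub>k c\<^sub>k (-4\<^sup>k)\<^sup>m = 1\<close> for all \<open>m\<close> makes all derivatives match at \<open>s = 0\<close>.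

  For part (ii), write \<open>x\<^sub>S\<close> for the product of the \<open>x\<^sub>j\<close>, \<open>j \<in> S\<close>, and \<open>a = \<nu> - \<mu>\<^sub>0 = k' + 1/2\<close>. For smooth \<open>G\<close>,
  \<open>T\<^sup>B\<^sub>i (x\<^sub>S G(x\<^sup>2))\<close> is \<open>2 x\<^sub>i x\<^sub>S (T\<^sup>A\<^sub>i G)(x\<^sup>2)\<close> if \<open>i \<notin> S\<close>, and otherwise \<open>2 x\<^sub>S x\<^sub>i\<^sup>-\<^sup>1 (D\<^sub>i G)(x\<^sup>2)\<close> where, with \<open>M\<close> the
  complement of \<open>S\<close>, \<open>D\<^sub>i G = y\<^sub>i T\<^sup>A\<^sub>i G + a G + k \<Sum>\<^sub>j\<^sub>\<in>\<^sub>M G \<circ> s\<^sub>i\<^sub>j\<close>. On the positive orthant the same \<open>D\<^sub>i\<close> arise from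
  conjugation: \<open>T\<^sup>A\<^sub>i (\<Delta>\<^sup>a y\<^sub>M\<^sup>-\<^sup>1 G) = \<Delta>\<^sup>a y\<^sub>M\<^sup>-\<^sup>1 y\<^sub>i\<^sup>-\<^sup>1 D\<^sub>i G\<close>. Iterating over all coordinates gives the identity, without
  using that the Dunkl operators commute.\<close>

section \<open>Iterated differentiability\<close>

text \<open>A finite-order counterpart of the coinductive \<open>smooth\<close>. The partials of
  products, inverses and compositions are sums of products of such functions, and these are handled
  by induction on the order rather than by direct coinduction.\<close>

primrec diffN :: "nat \<Rightarrow> (real ^ 'n::finite \<Rightarrow> complex) \<Rightarrow> bool" where
  "diffN 0 g = True"
| "diffN (Suc m) g = ((\<forall>x. g differentiable (at x)) \<and> (\<forall>i. diffN m (partial i g)))"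

lemma smooth_differentiable: "smooth g \<Longrightarrow> g differentiable (at x)"
  by (auto elim: smooth.cases)

lemma smooth_partial: "smooth g \<Longrightarrow> smooth (partial i g)"
  by (auto elim: smooth.cases)

lemma smooth_iff_diffN: "smooth g \<longleftrightarrow> (\<forall>m. diffN m g)"
proof
  assume "smooth g"
  have "smooth g \<Longrightarrow> diffN m g" for m g
    by (induction m arbitrary: g) (auto simp: smooth_differentiable smooth_partial)
  then show "\<forall>m. diffN m g" using \<open>smooth g\<close> by blast
next
  assume "\<forall>m. diffN m g"
  then show "smooth g"
  proof (coinduction arbitrary: g)
    case smooth
    have "g differentiable (at x)" for x
      using smooth[rule_format, of 1] by simp
    moreover have "diffN m (partial i g)" for i m
      using smooth[rule_format, of "Suc m"] by simp
    ultimately show ?case by blast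
  qed
qed

lemma diffN_SucD: "diffN (Suc m) g \<Longrightarrow> diffN m g"
  by (induction m arbitrary: g) auto

lemma has_partial:
  assumes "g differentiable (at x)"
  shows "((\<lambda>t. g (x + t *\<^sub>R axis i 1)) has_vector_derivative partial i g x) (at 0)"
proof -
  have "(\<lambda>t. g (x + t *\<^sub>R axis i 1)) differentiable (at 0)"
    by (rule differentiable_compose[where f=g]) (use assms in \<open>auto intro!: derivative_intros\<close>)
  then show ?thesis
    unfolding partial_def by (simp add: vector_derivative_works)
qed

lemma partial_eqI:
  assumes "((\<lambda>t. g (x + t *\<^sub>R axis i 1)) has_vector_derivative d) (at 0)"
  shows "partial i g x = d"
  unfolding partial_def using assms by (rule vector_derivative_at)

lemma has_derivative_partials:
  assumes "g differentiable (at x)"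
  shows "(g has_derivative (\<lambda>v. \<Sum>i\<in>UNIV. complex_of_real (v $ i) * partial i g x)) (at x)"
proof -
  obtain D where D: "(g has_derivative D) (at x)"
    using assms by (auto simp: differentiable_def)
  then have lin: "linear D" by (rule has_derivative_linear)
  have "((\<lambda>t. g (x + t *\<^sub>R axis i 1)) has_vector_derivative D (axis i 1)) (at 0)" for i
  proof -
    have "((\<lambda>t. x + t *\<^sub>R axis i 1) has_derivative (\<lambda>t. t *\<^sub>R axis i 1)) (at 0)"
      by (auto intro!: derivative_eq_intros)
    then have "((\<lambda>t. g (x + t *\<^sub>R axis i 1)) has_derivative (\<lambda>t. D (t *\<^sub>R axis i 1))) (at 0)"
      by (rule has_derivative_compose) (use D in simp)
    then show ?thesis
      unfolding has_vector_derivative_def by (simp add: linear_scale[OF lin])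
  qed
  then have p: "partial i g x = D (axis i 1)" for i by (rule partial_eqI)
  have "D v = (\<Sum>i\<in>UNIV. complex_of_real (v $ i) * partial i g x)" for v
  proof -
    have "D v = D (\<Sum>i\<in>UNIV. (v $ i) *\<^sub>R axis i 1)"
      by (simp add: basis_expansion flip: scalar_mult_eq_scaleR)
    also have "\<dots> = (\<Sum>i\<in>UNIV. (v $ i) *\<^sub>R D (axis i 1))"
      by (simp add: linear_sum[OF lin] linear_scale[OF lin])
    finally show ?thesis by (simp add: p scaleR_conv_of_real)
  qed
  then have "D = (\<lambda>v. \<Sum>i\<in>UNIV. complex_of_real (v $ i) * partial i g x)" by auto
  with D show ?thesis by simp
qed

lemma partial_eq_derivative:
  fixes g :: "real ^ 'n::finite \<Rightarrow> complex"
  assumes "(g has_derivative D) (at x)"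
  shows "partial i g x = D (axis i 1)"
proof -
  have "g differentiable (at x)" using assms by (auto simp: differentiable_def)
  from has_derivative_unique[OF has_derivative_partials[OF this] assms]
  have "D (axis i 1) = (\<Sum>l\<in>UNIV. complex_of_real ((axis i 1::real^'n) $ l) * partial l g x)"
    by metis
  also have "\<dots> = (\<Sum>l\<in>UNIV. if l = i then partial l g x else 0)"
    by (intro sum.cong) (auto simp: axis_def)
  finally show ?thesis by simp
qed

text \<open>The classical C^1 criterion. \<open>smooth\<close> asks for total derivatives, whereas
  parameter integrals and glued extensions only come with their partials. The induction frees one
  coordinate at a time and joins it to the earlier ones by the rule for two partial
  derivatives.\<close>

lemma has_derivative_of_continuous_partials:
  fixes g :: "real ^ 'n::finite \<Rightarrow> 'b::real_normed_vector"
  assumes d: "\<And>i x. ((\<lambda>t. g (x + t *\<^sub>R axis i 1)) has_vector_derivative g' i x) (at 0)"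
    and c: "\<And>i. continuous_on UNIV (g' i)"
  shows "(g has_derivative (\<lambda>v. \<Sum>i\<in>UNIV. v $ i *\<^sub>R g' i x)) (at x)"
proof -
  have "((\<lambda>v. g (x + (\<Sum>i\<in>S. (v $ i) *\<^sub>R axis i 1))) has_derivative
          (\<lambda>v. \<Sum>i\<in>S. v $ i *\<^sub>R g' i x)) (at 0)" if "finite S" for S
    using that
  proof (induction S)
    case empty
    then show ?case by simp
  next
    case (insert j S)
    let ?P = "\<lambda>v::real^'n. x + (\<Sum>i\<in>S. (v $ i) *\<^sub>R axis i 1)"
    have dt: "((\<lambda>t. g (?P v + t *\<^sub>R axis j 1)) has_derivative
        blinfun_apply (blinfun_scaleR_left (g' j (?P v + t *\<^sub>R axis j 1)))) (at t)" for v t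
    proof -
      have "((\<lambda>s. g ((?P v + t *\<^sub>R axis j 1) + s *\<^sub>R axis j 1)) has_vector_derivative
               g' j (?P v + t *\<^sub>R axis j 1)) (at (t - t))" using d by simp
      then have "((\<lambda>s. g ((?P v + t *\<^sub>R axis j 1) + s *\<^sub>R axis j 1)) \<circ> (\<lambda>s. s - t)
                  has_vector_derivative 1 *\<^sub>R g' j (?P v + t *\<^sub>R axis j 1)) (at t)"
        by (intro vector_diff_chain_at) (auto intro!: derivative_eq_intros)
      then show ?thesis
        by (simp add: has_vector_derivative_def o_def algebra_simps flip: scaleR_add_left)
    qed
    have fx: "((\<lambda>v. g (?P v + (0::real) *\<^sub>R axis j 1)) has_derivative (\<lambda>v. \<Sum>i\<in>S. v $ i *\<^sub>R g' i x)) (at 0)"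
      using insert.IH by simp
    have "continuous_on UNIV (\<lambda>(v, t). blinfun_scaleR_left (g' j (?P v + t *\<^sub>R axis j 1)))"
      unfolding case_prod_unfold
      by (intro bounded_linear.continuous_on[OF bounded_linear_blinfun_scaleR_left]
            continuous_on_compose2[OF c[of j]] continuous_intros) auto
    then have fc: "continuous (at (0, 0)) (\<lambda>(v, t). blinfun_scaleR_left (g' j (?P v + t *\<^sub>R axis j 1)))"
      by (simp add: continuous_on_eq_continuous_at)
    have "((\<lambda>(v, t). g (?P v + t *\<^sub>R axis j 1)) has_derivative
          (\<lambda>(tv, tt). (\<Sum>i\<in>S. tv $ i *\<^sub>R g' i x)
              + blinfun_apply (blinfun_scaleR_left (g' j (?P 0 + 0 *\<^sub>R axis j 1))) tt))
          (at (0, 0) within UNIV \<times> UNIV)"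
      by (rule has_derivative_partialsI[where X=UNIV and Y=UNIV and x=0 and y=0
            and f="\<lambda>v t. g (?P v + t *\<^sub>R axis j 1)"
            and fy="\<lambda>v t. blinfun_scaleR_left (g' j (?P v + t *\<^sub>R axis j 1))"])
         (rule fx dt convex_UNIV UNIV_I fc[folded UNIV_Times_UNIV])+
    then have 1: "((\<lambda>(v, t). g (?P v + t *\<^sub>R axis j 1)) has_derivative
          (\<lambda>(tv, tt). (\<Sum>i\<in>S. tv $ i *\<^sub>R g' i x) + tt *\<^sub>R g' j x)) (at (0, 0))"
      by simp
    \<comment> \<open>Restricting the two-variable function to the graph \<open>t = v $ j\<close>
      absorbs the new coordinate into the sum.\<close>
    have 2: "((\<lambda>v::real^'n. (v, v $ j)) has_derivative (\<lambda>v. (v, v $ j))) (at 0)"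
      by (rule bounded_linear_imp_has_derivative[OF bounded_linear_Pair[OF bounded_linear_ident bounded_linear_vec_nth]])
    have "((\<lambda>v::real^'n. (\<lambda>(v, t). g (?P v + t *\<^sub>R axis j 1)) (v, v $ j)) has_derivative
            (\<lambda>v. (\<lambda>(tv, tt). (\<Sum>i\<in>S. tv $ i *\<^sub>R g' i x) + tt *\<^sub>R g' j x) (v, v $ j))) (at 0)"
      by (rule has_derivative_compose[OF 2]) (use 1 in simp)
    then show ?case using insert.hyps by (simp add: algebra_simps)
  qed
  from this[of UNIV]
  have "((\<lambda>v. g (x + v)) has_derivative (\<lambda>v. \<Sum>i\<in>UNIV. v $ i *\<^sub>R g' i x)) (at 0)"
    by (simp add: basis_expansion flip: scalar_mult_eq_scaleR)
  then have "((\<lambda>v. g (x + v)) has_derivative (\<lambda>v. \<Sum>i\<in>UNIV. v $ i *\<^sub>R g' i x)) (at (x - x))" by simp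
  then have "((\<lambda>y. g (x + (y - x))) has_derivative (\<lambda>v. \<Sum>i\<in>UNIV. v $ i *\<^sub>R g' i x)) (at x)"
    by (rule has_derivative_compose[rotated]) (auto intro!: derivative_eq_intros)
  then show ?thesis by simp
qed

lemma diffN_SucI:
  assumes d: "\<And>i x. ((\<lambda>t. g (x + t *\<^sub>R axis i 1)) has_vector_derivative g' i x) (at 0)"
    and c: "\<And>i. continuous_on UNIV (g' i)"
    and m: "\<And>i. diffN m (g' i)"
  shows "diffN (Suc m) g"
proof -
  have "partial i g = g' i" for i using partial_eqI[OF d] by blast
  with has_derivative_of_continuous_partials[OF d c] m show ?thesis
    by (auto simp: differentiable_def)
qed

lemma smooth_continuous_on: "smooth g \<Longrightarrow> continuous_on S g"
  using smooth_differentiable differentiable_imp_continuous_within continuous_at_imp_continuous_on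
  by blast

lemma partial_const: "partial i (\<lambda>x. c) = (\<lambda>x. 0)"
  by (auto simp: partial_def)

lemma smooth_const: "smooth (\<lambda>x::real^'n::finite. c)"
proof -
  have "diffN m (\<lambda>x::real^'n. c)" for m and c :: complex
    by (induction m arbitrary: c) (auto simp: partial_const)
  then show ?thesis by (simp add: smooth_iff_diffN)
qed

lemma partial_add:
  assumes "f differentiable (at x)" "g differentiable (at x)"
  shows "partial i (\<lambda>x. f x + g x) x = partial i f x + partial i g x"
  by (rule partial_eqI) (intro derivative_intros has_partial assms)

lemma partial_mult:
  assumes "f differentiable (at x)" "g differentiable (at x)"
  shows "partial i (\<lambda>x. f x * g x) x = partial i f x * g x + f x * partial i g x"
proof (rule partial_eqI)
  show "((\<lambda>t. f (x + t *\<^sub>R axis i 1) * g (x + t *\<^sub>R axis i 1)) has_vector_derivative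
      partial i f x * g x + f x * partial i g x) (at 0)"
    using has_vector_derivative_mult[OF has_partial[OF assms(1), of i] has_partial[OF assms(2), of i]]
    by (simp add: algebra_simps)
qed

lemma diffN_add: "diffN m f \<Longrightarrow> diffN m g \<Longrightarrow> diffN m (\<lambda>x. f x + g x)"
proof (induction m arbitrary: f g)
  case (Suc m)
  then have "partial i (\<lambda>x. f x + g x) = (\<lambda>x. partial i f x + partial i g x)" for i
    by (auto simp: partial_add)
  with Suc show ?case by (auto intro!: derivative_intros)
qed simp

lemma diffN_mult: "diffN m f \<Longrightarrow> diffN m g \<Longrightarrow> diffN m (\<lambda>x. f x * g x)"
proof (induction m arbitrary: f g)
  case (Suc m)
  then have "partial i (\<lambda>x. f x * g x) = (\<lambda>x. partial i f x * g x + f x * partial i g x)" for i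
    by (auto simp: partial_mult)
  moreover have "diffN m f" "diffN m g" using Suc.prems diffN_SucD by blast+
  ultimately show ?case using Suc by (auto intro!: derivative_intros diffN_add)
qed simp

lemma smooth_add: "smooth f \<Longrightarrow> smooth g \<Longrightarrow> smooth (\<lambda>x. f x + g x)"
  by (simp add: smooth_iff_diffN diffN_add)

lemma smooth_mult: "smooth f \<Longrightarrow> smooth g \<Longrightarrow> smooth (\<lambda>x. f x * g x)"
  by (simp add: smooth_iff_diffN diffN_mult)

lemma diffN_const: "diffN m (\<lambda>x. c)"
  using smooth_const smooth_iff_diffN by blast

lemma smooth_diff:
  assumes "smooth f" "smooth g"
  shows "smooth (\<lambda>x. f x - g x)"
  using smooth_add[OF assms(1) smooth_mult[OF smooth_const[of "-1"] assms(2)]] by simp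

lemma diffN_sum: "(\<And>a. a \<in> A \<Longrightarrow> diffN m (f a)) \<Longrightarrow> diffN m (\<lambda>x. \<Sum>a\<in>A. f a x)"
  by (induction A rule: infinite_finite_induct) (auto simp: diffN_const intro!: diffN_add)

lemma smooth_sum: "(\<And>a. a \<in> A \<Longrightarrow> smooth (f a)) \<Longrightarrow> smooth (\<lambda>x. \<Sum>a\<in>A. f a x)"
  by (simp add: smooth_iff_diffN diffN_sum)

lemma smooth_nth: "smooth (\<lambda>x::real^'n::finite. complex_of_real (x $ l))"
proof -
  have D: "((\<lambda>x::real^'n. complex_of_real (x $ l)) has_derivative (\<lambda>v. complex_of_real (v $ l))) (at x)" for x
    by (intro has_derivative_of_real bounded_linear.has_derivative[OF bounded_linear_vec_nth] has_derivative_ident)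
  have "partial i (\<lambda>x::real^'n. complex_of_real (x $ l)) = (\<lambda>x. complex_of_real (axis i 1 $ l))" for i
    by (rule ext) (rule partial_eq_derivative[OF D])
  then have "smooth (partial i (\<lambda>x::real^'n. complex_of_real (x $ l)))" for i
    by (simp only: smooth_const)
  with D show ?thesis by (intro smooth.intros[of "\<lambda>x::real^'n. complex_of_real (x $ l)"]) (auto simp: differentiable_def)
qed

lemma diffN_inverse:
  fixes g :: "real ^ 'n::finite \<Rightarrow> complex"
  assumes "\<And>x. g x \<noteq> 0"
  shows "diffN m g \<Longrightarrow> diffN m (\<lambda>x. inverse (g x))"
proof (induction m)
  case (Suc m)
  have D: "((\<lambda>x. inverse (g x)) has_derivative (\<lambda>v::real^'n. - (inverse (g x) * (\<Sum>i\<in>UNIV. complex_of_real (v $ i) * partial i g x) * inverse (g x)))) (at x)" for x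
    by (rule Deriv.has_derivative_inverse[of g x, OF assms]) (rule has_derivative_partials, use Suc.prems in simp)
  have p: "partial i (\<lambda>x. inverse (g x)) = (\<lambda>x. (-1) * (inverse (g x) * partial i g x * inverse (g x)))" for i
  proof
    fix x
    have "(\<Sum>l\<in>UNIV. complex_of_real (axis i 1 $ l) * partial l g x) = (\<Sum>l\<in>UNIV. if l = i then partial l g x else 0)"
      by (intro sum.cong) (auto simp: axis_def)
    then show "partial i (\<lambda>x. inverse (g x)) x = (-1) * (inverse (g x) * partial i g x * inverse (g x))"
      by (simp add: partial_eq_derivative[OF D])
  qed
  have "diffN m (\<lambda>x. inverse (g x))" using Suc diffN_SucD by blast
  moreover have "diffN m (partial i g)" for i using Suc.prems by simp
  ultimately have "diffN m (partial i (\<lambda>x. inverse (g x)))" for i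
    unfolding p by (intro diffN_mult diffN_const)
  then show ?case using D by (simp add: differentiable_def) blast
qed simp

lemma has_derivative_vecI:
  fixes \<phi> :: "'a::real_normed_vector \<Rightarrow> real ^ 'm::finite"
  assumes "\<And>l. ((\<lambda>x. \<phi> x $ l) has_derivative D l) (at x)"
  shows "(\<phi> has_derivative (\<lambda>v. \<chi> l. D l v)) (at x)"
proof (subst has_derivative_componentwise_within, intro ballI)
  fix b :: "real ^ 'm" assume "b \<in> Basis"
  then obtain l where "b = axis l 1" by (auto simp: Basis_vec_def)
  with assms[of l] show "((\<lambda>x. \<phi> x \<bullet> b) has_derivative (\<lambda>v. (\<chi> l. D l v) \<bullet> b)) (at x)"
    by (simp add: inner_axis)
qed

text \<open>The chain rule writes each partial as a sum of products of a fixed smooth function and a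
  composition with a partial of \<open>g\<close>, so induction on the order applies with
  \<open>g\<close> arbitrary.\<close>

lemma smooth_compose:
  fixes \<phi> :: "real ^ 'n::finite \<Rightarrow> real ^ 'm::finite"
  assumes "smooth g" and \<phi>: "\<And>l. smooth (\<lambda>x. complex_of_real (\<phi> x $ l))"
  shows "smooth (\<lambda>x. g (\<phi> x))"
proof -
  define \<phi>' where "\<phi>' = (\<lambda>x (v::real^'n) l. \<Sum>i\<in>UNIV. complex_of_real (v $ i) * partial i (\<lambda>x. complex_of_real (\<phi> x $ l)) x)"
  have d: "((\<lambda>x. complex_of_real (\<phi> x $ l)) has_derivative (\<lambda>v. \<phi>' x v l)) (at x)" for x l
    unfolding \<phi>'_def by (rule has_derivative_partials) (use \<phi> smooth_differentiable in blast)
  have dRe: "((\<lambda>x. \<phi> x $ l) has_derivative (\<lambda>v. Re (\<phi>' x v l))) (at x)" for x l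
    using bounded_linear.has_derivative[OF bounded_linear_Re d[of l x]] by simp
  \<comment> \<open>The derivative of an embedded real function is real, by uniqueness of
    derivatives; this lets the components of the map be treated as complex functions.\<close>
  have Re: "complex_of_real (Re (\<phi>' x v l)) = \<phi>' x v l" for x v l
  proof -
    have "((\<lambda>x. complex_of_real (\<phi> x $ l)) has_derivative (\<lambda>v. complex_of_real (Re (\<phi>' x v l)))) (at x)"
      by (rule has_derivative_of_real[OF dRe])
    from has_derivative_unique[OF this d] show ?thesis by metis
  qed
  have D: "(\<phi> has_derivative (\<lambda>v. \<chi> l. Re (\<phi>' x v l))) (at x)" for x
    by (rule has_derivative_vecI[OF dRe])
  have ax: "\<phi>' x (axis i 1) l = partial i (\<lambda>x. complex_of_real (\<phi> x $ l)) x" for x i l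
    by (rule partial_eq_derivative[OF d, symmetric])
  have "diffN m g \<Longrightarrow> diffN m (\<lambda>x. g (\<phi> x))" for m
  proof (induction m arbitrary: g)
    case (Suc m)
    have D': "((\<lambda>x. g (\<phi> x)) has_derivative (\<lambda>v. \<Sum>l\<in>UNIV. \<phi>' x v l * partial l g (\<phi> x))) (at x)" for x
      using has_derivative_compose[OF D has_derivative_partials, of g x] Suc.prems by (simp add: Re)
    have "partial i (\<lambda>x. g (\<phi> x)) =
        (\<lambda>x. \<Sum>l\<in>UNIV. partial i (\<lambda>x. complex_of_real (\<phi> x $ l)) x * partial l g (\<phi> x))" for i
      by (rule ext) (simp only: partial_eq_derivative[OF D'] ax)
    moreover have "diffN m (partial i (\<lambda>x. complex_of_real (\<phi> x $ l)))" for i l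
      using smooth_partial[OF \<phi>] smooth_iff_diffN by blast
    ultimately have "diffN m (partial i (\<lambda>x. g (\<phi> x)))" for i
      using Suc by (auto intro!: diffN_sum diffN_mult)
    then show ?case using D' by (auto simp: differentiable_def)
  qed simp
  then show ?thesis using assms(1) by (simp add: smooth_iff_diffN)
qed

section \<open>Difference quotients of reflections\<close>

lemma partials_along_line:
  assumes "g differentiable (at (x + s *\<^sub>R v))"
  shows "((\<lambda>t. g (x + t *\<^sub>R v)) has_vector_derivative
            (\<Sum>i\<in>UNIV. complex_of_real (v $ i) * partial i g (x + s *\<^sub>R v))) (at s)"
proof -
  have "((\<lambda>t. x + t *\<^sub>R v) has_derivative (\<lambda>t. t *\<^sub>R v)) (at s)"
    by (auto intro!: derivative_eq_intros)
  from has_derivative_compose[OF this has_derivative_partials[OF assms]]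
  show ?thesis
    unfolding has_vector_derivative_def by (simp add: scaleR_conv_of_real[where 'a=complex] sum_distrib_left mult.assoc)
qed

text \<open>Differentiation under the integral sign. The chain rule brings out a factor
  \<open>t\<close>, so the induction on the order runs over integrals with an arbitrary continuous
  weight \<open>c t\<close>; the lemma is the case of weight 1.\<close>

lemma smooth_segment_integral:
  fixes g :: "real ^ 'n::finite \<Rightarrow> complex" and w :: "real ^ 'n"
  assumes "smooth g" and l: "linear l"
  shows "smooth (\<lambda>y. integral {0..1} (\<lambda>t::real. g (y - (t * l y) *\<^sub>R w)))"
proof -
  have lc[continuous_intros]: "continuous_on A (\<lambda>x. l (h x))" if "continuous_on A h"
    for h :: "'b::topological_space \<Rightarrow> real ^ 'n" and A
    by (rule bounded_linear.continuous_on[OF linear_conv_bounded_linear[THEN iffD1, OF l] that])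
  let ?I = "\<lambda>(c::real\<Rightarrow>real) g y. integral (cbox 0 1) (\<lambda>t::real. complex_of_real (c t) * g (y - (t * l y) *\<^sub>R w))"
  \<comment> \<open>As \<open>y\<close> moves along \<open>axis i 1\<close>, the integrand's
    argument moves along \<open>axis i 1\<close> minus \<open>t * l (axis i 1)\<close> times
    \<open>w\<close>. The first part keeps the weight \<open>c t\<close>, the second turns it into
    \<open>t * c t\<close>.\<close>
  let ?I' = "\<lambda>c i g y. ?I c (partial i g) y + (\<Sum>j\<in>UNIV. complex_of_real (- l (axis i 1) * w $ j) * ?I (\<lambda>t. t * c t) (partial j g) y)"
  have C: "continuous_on (U \<times> cbox 0 1) (\<lambda>(y, t). complex_of_real (c t) * g (y - (t * l y) *\<^sub>R w))"
    if "smooth g" "continuous_on UNIV c" for g and c :: "real \<Rightarrow> real" and U :: "(real^'n) set"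
    unfolding case_prod_unfold
    by (intro continuous_intros continuous_on_compose2[OF smooth_continuous_on[OF that(1)]]
         continuous_on_compose2[OF that(2)]) auto
  have CI: "continuous_on UNIV (?I c g)" if "smooth g" "continuous_on UNIV c" for g c
    by (rule integral_continuous_on_param[OF C[OF that]])
  have int: "(\<lambda>t. complex_of_real (c t) * g (y - (t * l y) *\<^sub>R w)) integrable_on cbox 0 1"
    if "smooth g" "continuous_on UNIV c" for g c y
    unfolding cbox_interval
    by (intro integrable_continuous_interval continuous_intros continuous_on_compose2[OF smooth_continuous_on[OF that(1)]]
         continuous_on_compose2[OF that(2)]) auto
  have D: "((\<lambda>s. ?I c g (y + s *\<^sub>R axis i 1)) has_vector_derivative ?I' c i g y) (at 0)"
    if g: "smooth g" and c: "continuous_on UNIV c" for c g i y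
  proof -
    define dg where "dg = (\<lambda>y t. complex_of_real (c t) * partial i g (y - (t * l y) *\<^sub>R w)
         + (\<Sum>j\<in>UNIV. complex_of_real (- l (axis i 1) * w $ j) * (complex_of_real (t * c t) * partial j g (y - (t * l y) *\<^sub>R w))))"
    have "((\<lambda>s. ?I c g (y + s *\<^sub>R axis i 1)) has_vector_derivative
            integral (cbox 0 1) (dg (y + 0 *\<^sub>R axis i 1))) (at 0 within UNIV)"
    proof (rule leibniz_rule_vector_derivative)
      fix s t :: real assume "t \<in> cbox 0 1"
      let ?v = "axis i 1 - (t * l (axis i 1)) *\<^sub>R w"
      have e: "y + s *\<^sub>R axis i 1 - (t * l (y + s *\<^sub>R axis i 1)) *\<^sub>R w = (y - (t * l y) *\<^sub>R w) + s *\<^sub>R ?v" for s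
        by (simp add: linear_add[OF l] linear_scale[OF l] algebra_simps)
      have vi: "complex_of_real (?v $ j) * z = (if j = i then z else 0) + complex_of_real (- l (axis i 1) * w $ j * t) * z" for j z
        by (auto simp: axis_def algebra_simps)
      have "((\<lambda>s. g ((y - (t * l y) *\<^sub>R w) + s *\<^sub>R ?v)) has_vector_derivative
         (\<Sum>j\<in>UNIV. complex_of_real (?v $ j) * partial j g ((y - (t * l y) *\<^sub>R w) + s *\<^sub>R ?v))) (at s)"
        by (rule partials_along_line) (rule smooth_differentiable[OF g])
      then have "((\<lambda>s. g (y + s *\<^sub>R axis i 1 - (t * l (y + s *\<^sub>R axis i 1)) *\<^sub>R w)) has_vector_derivative
         (\<Sum>j\<in>UNIV. complex_of_real (?v $ j) * partial j g (y + s *\<^sub>R axis i 1 - (t * l (y + s *\<^sub>R axis i 1)) *\<^sub>R w))) (at s)"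
        unfolding e .
      from has_vector_derivative_mult_right[OF this, of "complex_of_real (c t)"]
      have "((\<lambda>s. complex_of_real (c t) * g (y + s *\<^sub>R axis i 1 - (t * l (y + s *\<^sub>R axis i 1)) *\<^sub>R w)) has_vector_derivative
         complex_of_real (c t) * (\<Sum>j\<in>UNIV. complex_of_real (?v $ j) * partial j g (y + s *\<^sub>R axis i 1 - (t * l (y + s *\<^sub>R axis i 1)) *\<^sub>R w))) (at s)" .
      also have "complex_of_real (c t) * (\<Sum>j\<in>UNIV. complex_of_real (?v $ j) * partial j g (y + s *\<^sub>R axis i 1 - (t * l (y + s *\<^sub>R axis i 1)) *\<^sub>R w))
          = dg (y + s *\<^sub>R axis i 1) t"
        unfolding vi dg_def sum.distrib distrib_left by (simp add: sum_distrib_left mult_ac)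
      finally show "((\<lambda>s. complex_of_real (c t) * g (y + s *\<^sub>R axis i 1 - (t * l (y + s *\<^sub>R axis i 1)) *\<^sub>R w)) has_vector_derivative
         dg (y + s *\<^sub>R axis i 1) t) (at s within UNIV)" by simp
    next
      show "(\<lambda>t. complex_of_real (c t) * g (y + s *\<^sub>R axis i 1 - (t * l (y + s *\<^sub>R axis i 1)) *\<^sub>R w)) integrable_on cbox 0 1" for s
        by (rule int[OF g c])
      show "continuous_on (UNIV \<times> cbox 0 1) (\<lambda>(s, t). dg (y + s *\<^sub>R axis i 1) t)"
        unfolding case_prod_unfold dg_def
        by (intro continuous_intros continuous_on_compose2[OF smooth_continuous_on[OF smooth_partial[OF g]]]
            continuous_on_compose2[OF c]) auto
    qed auto
    also have "integral (cbox 0 1) (dg (y + 0 *\<^sub>R axis i 1)) = ?I' c i g y"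
    proof -
      have c': "continuous_on UNIV (\<lambda>t. t * c t)" by (intro continuous_intros c)
      note ii = int[OF smooth_partial[OF g] c] int[OF smooth_partial[OF g] c']
      have "(dg y has_integral ?I' c i g y) (cbox 0 1)" unfolding dg_def
        by (intro has_integral_add has_integral_sum has_integral_mult_right integrable_integral ii finite)
      then show ?thesis by (simp add: integral_unique)
    qed
    finally show ?thesis by simp
  qed
  have "diffN m (?I c g)" if "smooth g" "continuous_on UNIV c" for m c g
    using that
  proof (induction m arbitrary: c g)
    case (Suc m)
    have c': "continuous_on UNIV (\<lambda>t. t * c t)" by (intro continuous_intros Suc.prems)
    show ?case
    proof (rule diffN_SucI)
      show "((\<lambda>s. ?I c g (y + s *\<^sub>R axis i 1)) has_vector_derivative ?I' c i g y) (at 0)" for i y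
        by (rule D[OF Suc.prems])
      show "continuous_on UNIV (?I' c i g)" for i
        by (intro continuous_intros CI smooth_partial Suc.prems c')
      show "diffN m (?I' c i g)" for i
        by (intro diffN_add diffN_sum diffN_mult diffN_const Suc.IH smooth_partial Suc.prems c')
    qed
  qed simp
  from this[OF assms(1), of "\<lambda>_. 1"] show ?thesis
    by (simp add: smooth_iff_diffN)
qed

text \<open>Hadamard's lemma: integrating the derivative of \<open>g\<close> along the segment from
  \<open>y\<close> to its image lets the factor \<open>l y\<close> be pulled out, and what remains
  is a sum of smooth segment integrals.\<close>

lemma reflection_quotient_exists:
  fixes g :: "real ^ 'n::finite \<Rightarrow> complex" and w :: "real ^ 'n"
  assumes g: "smooth g" and l: "linear l"
  obtains q where "smooth q" "\<And>y. g y - g (y - l y *\<^sub>R w) = complex_of_real (l y) * q y"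
proof
  define q where "q = (\<lambda>y. \<Sum>i\<in>UNIV. complex_of_real (w $ i) * integral {0..1} (\<lambda>t. partial i g (y - (t * l y) *\<^sub>R w)))"
  show "smooth q" unfolding q_def
    by (intro smooth_sum smooth_mult smooth_const smooth_segment_integral smooth_partial g l)
  fix y
  have D: "((\<lambda>t. g (y - (t * l y) *\<^sub>R w)) has_vector_derivative
      - (complex_of_real (l y) * (\<Sum>i\<in>UNIV. complex_of_real (w $ i) * partial i g (y - (t * l y) *\<^sub>R w)))) (at t)" for t
  proof -
    have "y + t *\<^sub>R (- l y *\<^sub>R w) = y - (t * l y) *\<^sub>R w" for t by simp
    with partials_along_line[where x=y and s=t and v="- l y *\<^sub>R w", OF smooth_differentiable[OF g]]
    show ?thesis by (simp add: sum_distrib_left sum_negf mult.assoc)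
  qed
  have "((\<lambda>t. - (complex_of_real (l y) * (\<Sum>i\<in>UNIV. complex_of_real (w $ i) * partial i g (y - (t * l y) *\<^sub>R w))))
       has_integral (g (y - (1 * l y) *\<^sub>R w) - g (y - (0 * l y) *\<^sub>R w))) {0..1}"
    by (rule fundamental_theorem_of_calculus) (auto intro: has_vector_derivative_at_within D)
  moreover have "(\<lambda>t. partial i g (y - (t * l y) *\<^sub>R w)) integrable_on {0..1}" for i
    by (intro integrable_continuous_interval continuous_on_compose2[OF smooth_continuous_on[OF smooth_partial[OF g]]]
        continuous_intros) auto
  then have "((\<lambda>t. - (complex_of_real (l y) * (\<Sum>i\<in>UNIV. complex_of_real (w $ i) * partial i g (y - (t * l y) *\<^sub>R w))))
       has_integral (- (complex_of_real (l y) * q y))) {0..1}"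
    unfolding q_def
    by (intro has_integral_neg has_integral_mult_right has_integral_sum) (auto simp: has_integral_integral)
  ultimately have "g (y - (1 * l y) *\<^sub>R w) - g (y - (0 * l y) *\<^sub>R w) = - (complex_of_real (l y) * q y)"
    by (rule has_integral_unique)
  then show "g y - g (y - l y *\<^sub>R w) = complex_of_real (l y) * q y"
    by (simp add: algebra_simps)
qed

text \<open>The local version is needed because powers of \<open>\<Delta>\<close> are smooth on the open orthant only.\<close>

lemma dquot_eqI:
  fixes x :: "real ^ 'n::finite"
  assumes l: "linear l" "l v \<noteq> 0" and U: "open U" "x \<in> U"
    and q: "\<And>y. y \<in> U \<Longrightarrow> g y - g (\<sigma> y) = complex_of_real (l y) * q y"
    and c: "continuous (at x) q"
  shows "dquot l \<sigma> g x = q x"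
proof (cases "l x = 0")
  case False
  then show ?thesis using q[OF U(2)] by (simp add: dquot_def)
next
  case True
  let ?S = "{y. l y \<noteq> 0}" and ?q = "\<lambda>y. (g y - g (\<sigma> y)) / complex_of_real (l y)"
  \<comment> \<open>\<open>Lim\<close> is determined only along a non-trivial filter; moving from
    \<open>x\<close> in the direction \<open>v\<close> leaves the hyperplane at once.\<close>
  have nt: "at x within ?S \<noteq> bot"
  proof -
    have "x islimpt ?S"
    proof (rule islimptI)
      fix T assume T: "x \<in> T" "open T"
      have "((\<lambda>t. x + t *\<^sub>R v) \<longlongrightarrow> x + 0 *\<^sub>R v) (at (0::real))"
        by (intro tendsto_intros)
      then have "eventually (\<lambda>t. x + t *\<^sub>R v \<in> T) (at (0::real))"
        using T by (auto elim: topological_tendstoD)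
      moreover have "eventually (\<lambda>t::real. t \<noteq> 0) (at 0)" by (simp add: eventually_at_filter)
      ultimately have "eventually (\<lambda>t. x + t *\<^sub>R v \<in> T \<and> t \<noteq> 0) (at (0::real))" by eventually_elim auto
      then obtain t :: real where "x + t *\<^sub>R v \<in> T" "t \<noteq> 0"
        using eventually_happens[of _ "at (0::real)"] by auto
      moreover from this have "l (x + t *\<^sub>R v) \<noteq> 0" "x + t *\<^sub>R v \<noteq> x"
        using True l by (auto simp: linear_add linear_scale linear_0)
      ultimately show "\<exists>y\<in>?S. y \<in> T \<and> y \<noteq> x" by blast
    qed
    then show ?thesis by (simp add: trivial_limit_within)
  qed
  have "(q \<longlongrightarrow> q x) (at x within ?S)"
    using c by (auto simp: continuous_at intro: tendsto_within_subset)
  moreover have "eventually (\<lambda>y. q y = ?q y) (at x within ?S)"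
    using U q by (auto simp: eventually_at_topological intro!: exI[of _ U])
  ultimately have "(?q \<longlongrightarrow> q x) (at x within ?S)" by (rule Lim_transform_eventually)
  with nt have "Lim (at x within ?S) ?q = q x" by (intro tendsto_Lim)
  with True show ?thesis by (simp add: dquot_def)
qed

lemma dquot_eq_global:
  fixes x :: "real ^ 'n::finite"
  assumes l: "linear l" "l v \<noteq> 0"
    and q: "\<And>y. g y - g (\<sigma> y) = complex_of_real (l y) * q y"
    and c: "continuous_on UNIV q"
  shows "dquot l \<sigma> g x = q x"
  using assms by (intro dquot_eqI[where U=UNIV]) (auto simp: continuous_on_eq_continuous_at)

section \<open>Dunkl operators on functions of the squares\<close>

definition xprod :: "'n set \<Rightarrow> real ^ 'n::finite \<Rightarrow> complex" where
  "xprod S x = (\<Prod>i\<in>S. complex_of_real (x $ i))"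

lemma xprod_UNIV: "xprod UNIV x = complex_of_real (Delta x)"
  by (simp add: xprod_def Delta_def)

lemma xprod_empty [simp]: "xprod {} x = 1"
  by (simp add: xprod_def)

lemma xprod_insert: "i \<notin> S \<Longrightarrow> xprod (insert i S) x = complex_of_real (x $ i) * xprod S x"
  by (simp add: xprod_def)

lemma xprod_cong: "(\<And>i. i \<in> S \<Longrightarrow> x $ i = y $ i) \<Longrightarrow> xprod S x = xprod S y"
  by (simp add: xprod_def)

lemma continuous_on_xprod [continuous_intros]:
  "continuous_on A h \<Longrightarrow> continuous_on A (\<lambda>x. xprod S (h x))"
  unfolding xprod_def by (intro continuous_intros)

lemma continuous_on_sqv [continuous_intros]:
  "continuous_on A h \<Longrightarrow> continuous_on A (\<lambda>x. sqv (h x))"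
  unfolding sqv_def by (intro continuous_intros)

lemma continuous_on_swapv [continuous_intros]:
  "continuous_on A h \<Longrightarrow> continuous_on A (\<lambda>x. swapv i j (h x))"
  unfolding swapv_def by (intro continuous_intros)

lemma continuous_on_smooth:
  "smooth g \<Longrightarrow> continuous_on A h \<Longrightarrow> continuous_on A (\<lambda>x. g (h x))"
  by (rule continuous_on_compose2[OF smooth_continuous_on]) auto

lemma sqv_nth [simp]: "sqv x $ i = (x $ i)\<^sup>2"
  by (simp add: sqv_def)

lemma swapv_nth: "swapv i j x $ l = (if l = i then x $ j else if l = j then x $ i else x $ l)"
  by (auto simp: swapv_def Transposition.transpose_def)

lemma tauv_nth: "tauv i j x $ l = (if l = i then - (x $ j) else if l = j then - (x $ i) else x $ l)"
  by (simp add: tauv_def)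

lemma sign_change_nth: "sign_change S x $ l = (if l \<in> S then - (x $ l) else x $ l)"
  by (simp add: sign_change_def)

lemma sqv_swapv: "sqv (swapv i j x) = swapv i j (sqv x)"
  by (simp add: vec_eq_iff swapv_nth)

lemma sqv_tauv: "sqv (tauv i j x) = swapv i j (sqv x)"
  by (simp add: vec_eq_iff swapv_nth tauv_nth)

lemma sqv_sign_change: "sqv (sign_change S x) = sqv x"
  by (simp add: vec_eq_iff sign_change_def)

lemma linear_nth_diff: "linear (\<lambda>y::real^'n::finite. y $ i - y $ j)"
  by (intro linearI) (auto simp: algebra_simps)

lemma linear_nth_add: "linear (\<lambda>y::real^'n::finite. y $ i + y $ j)"
  by (intro linearI) (auto simp: algebra_simps)

lemma linear_nth: "linear (\<lambda>y::real^'n::finite. y $ i)"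
  by (intro linearI) auto

section \<open>Difference quotients of the type B reflections\<close>

abbreviation swap_quot :: "'n \<Rightarrow> 'n \<Rightarrow> (real ^ 'n::finite \<Rightarrow> complex) \<Rightarrow> real ^ 'n \<Rightarrow> complex" where
  "swap_quot i j \<equiv> dquot (\<lambda>y. y $ i - y $ j) (swapv i j)"

abbreviation tau_quot :: "'n \<Rightarrow> 'n \<Rightarrow> (real ^ 'n::finite \<Rightarrow> complex) \<Rightarrow> real ^ 'n \<Rightarrow> complex" where
  "tau_quot i j \<equiv> dquot (\<lambda>y. y $ i + y $ j) (tauv i j)"

abbreviation sign_quot :: "'n \<Rightarrow> (real ^ 'n::finite \<Rightarrow> complex) \<Rightarrow> real ^ 'n \<Rightarrow> complex" where
  "sign_quot i \<equiv> dquot (\<lambda>y. y $ i) (sign_change {i})"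

lemma swap_quot_eqI:
  assumes "i \<noteq> j" "\<And>y. g y - g (swapv i j y) = complex_of_real (y $ i - y $ j) * q y"
    and "continuous_on UNIV q"
  shows "swap_quot i j g = q"
  by (rule ext, rule dquot_eq_global[OF linear_nth_diff[of i j], where v="axis i 1"])
     (use assms in \<open>auto simp: axis_def\<close>)

lemma tau_quot_eqI:
  assumes "i \<noteq> j" "\<And>y. g y - g (tauv i j y) = complex_of_real (y $ i + y $ j) * q y"
    and "continuous_on UNIV q"
  shows "tau_quot i j g = q"
  by (rule ext, rule dquot_eq_global[OF linear_nth_add[of i j], where v="axis i 1"])
     (use assms in \<open>auto simp: axis_def\<close>)

lemma sign_quot_eqI:
  assumes "\<And>y. g y - g (sign_change {i} y) = complex_of_real (y $ i) * q y"
    and "continuous_on UNIV q"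
  shows "sign_quot i g = q"
  by (rule ext, rule dquot_eq_global[OF linear_nth[of i], where v="axis i 1"])
     (use assms in \<open>auto simp: axis_def\<close>)

text \<open>The limit hidden in \<open>dquot\<close> is identified with the Hadamard quotient. From
  here on a difference quotient is used through its product equation, valid on the hyperplane as
  well, instead of through division.\<close>

lemma smooth_swap_quot:
  assumes g: "smooth g" and ij: "i \<noteq> j"
  shows "smooth (swap_quot i j g)"
    and "g y - g (swapv i j y) = complex_of_real (y $ i - y $ j) * swap_quot i j g y"
proof -
  obtain q where q: "smooth q" "\<And>y. g y - g (y - (y $ i - y $ j) *\<^sub>R (axis i 1 - axis j 1))
      = complex_of_real (y $ i - y $ j) * q y"
    using reflection_quotient_exists[OF g linear_nth_diff] by metis
  have "swapv i j y = y - (y $ i - y $ j) *\<^sub>R (axis i 1 - axis j 1)" for y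
    using ij by (auto simp: vec_eq_iff swapv_nth axis_def)
  with q(2) have q2: "g y - g (swapv i j y) = complex_of_real (y $ i - y $ j) * q y" for y
    by simp
  then have "swap_quot i j g = q"
    by (rule swap_quot_eqI[OF ij _ smooth_continuous_on[OF q(1)]])
  with q q2 show "smooth (swap_quot i j g)"
    "g y - g (swapv i j y) = complex_of_real (y $ i - y $ j) * swap_quot i j g y"
    by simp_all
qed

lemma smooth_dunklA: "smooth g \<Longrightarrow> smooth (dunklA k i g)"
  unfolding dunklA_def
  by (intro smooth_add smooth_mult smooth_const smooth_sum smooth_partial) (auto intro: smooth_swap_quot)

lemma smooth_swapv: "smooth g \<Longrightarrow> smooth (\<lambda>y. g (swapv i j y))"
  by (rule smooth_compose) (auto simp: swapv_def intro: smooth_nth)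

text \<open>The operator \<open>D_i\<close> of the overview. In the iterations, \<open>M\<close> is
  the set of coordinates already processed.\<close>

definition dunkl_shift ::
  "complex \<Rightarrow> real \<Rightarrow> 'n set \<Rightarrow> 'n::finite \<Rightarrow> (real ^ 'n \<Rightarrow> complex) \<Rightarrow> real ^ 'n \<Rightarrow> complex" where
  "dunkl_shift a k M i g y = complex_of_real (y $ i) * dunklA k i g y + a * g y
     + complex_of_real k * (\<Sum>j\<in>M. g (swapv i j y))"

lemma smooth_dunkl_shift: "smooth g \<Longrightarrow> smooth (dunkl_shift a k M i g)"
  unfolding dunkl_shift_def
  by (intro smooth_add smooth_mult smooth_const smooth_sum smooth_dunklA smooth_nth smooth_swapv)

lemma partial_sqv:
  assumes "smooth G"
  shows "((\<lambda>t. G (sqv (x + t *\<^sub>R axis i 1))) has_vector_derivative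
           2 * complex_of_real (x $ i) * partial i G (sqv x)) (at 0)"
proof -
  have e: "sqv (x + t *\<^sub>R axis i 1) = sqv x + (2 * x $ i * t + t\<^sup>2) *\<^sub>R axis i 1" for t
    by (auto simp: vec_eq_iff axis_def power2_eq_square algebra_simps)
  have "((\<lambda>t. 2 * x $ i * t + t\<^sup>2) has_vector_derivative 2 * x $ i) (at 0)"
    by (auto intro!: derivative_eq_intros simp flip: has_real_derivative_iff_has_vector_derivative)
  from vector_diff_chain_at[OF this, of "\<lambda>t. G (sqv x + t *\<^sub>R axis i 1)"]
    has_partial[OF smooth_differentiable[OF assms], of "sqv x" i]
  show ?thesis by (simp add: o_def e scaleR_conv_of_real[where 'a=complex])
qed

lemma partial_xprod_sqv_out:
  assumes "smooth G" "i \<notin> S"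
  shows "partial i (\<lambda>x. c * xprod S x * G (sqv x)) x =
           c * xprod S x * (2 * complex_of_real (x $ i) * partial i G (sqv x))"
proof (rule partial_eqI)
  have "xprod S (x + t *\<^sub>R axis i 1) = xprod S x" for t
    using assms(2) by (intro xprod_cong) (auto simp: axis_def)
  then show "((\<lambda>t. c * xprod S (x + t *\<^sub>R axis i 1) * G (sqv (x + t *\<^sub>R axis i 1))) has_vector_derivative
     c * xprod S x * (2 * complex_of_real (x $ i) * partial i G (sqv x))) (at 0)"
    by (simp only:) (rule has_vector_derivative_mult_right[OF partial_sqv[OF assms(1)]])
qed

lemma partial_xprod_sqv_in:
  assumes "smooth G" "i \<notin> S"
  shows "partial i (\<lambda>x. c * xprod (insert i S) x * G (sqv x)) x =
           c * xprod S x * (G (sqv x) + 2 * (complex_of_real (x $ i))\<^sup>2 * partial i G (sqv x))"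
proof (rule partial_eqI)
  have "xprod S (x + t *\<^sub>R axis i 1) = xprod S x" for t
    using assms(2) by (intro xprod_cong) (auto simp: axis_def)
  then have e: "xprod (insert i S) (x + t *\<^sub>R axis i 1) = complex_of_real (x $ i + t) * xprod S x" for t
    using assms(2) by (simp add: xprod_insert)
  have "((\<lambda>t. complex_of_real (x $ i + t)) has_vector_derivative 1) (at 0)"
    by (auto intro!: derivative_eq_intros has_vector_derivative_of_real)
  from has_vector_derivative_mult_right[OF has_vector_derivative_mult[OF this partial_sqv[OF assms(1), of x i]],
     of "c * xprod S x"]
  show "((\<lambda>t. c * xprod (insert i S) (x + t *\<^sub>R axis i 1) * G (sqv (x + t *\<^sub>R axis i 1))) has_vector_derivative
     c * xprod S x * (G (sqv x) + 2 * (complex_of_real (x $ i))\<^sup>2 * partial i G (sqv x))) (at 0)"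
    unfolding e by (simp add: algebra_simps power2_eq_square)
qed

lemma xprod_reflect_out:
  assumes "i \<notin> S" "j \<notin> S"
  shows "xprod S (swapv i j x) = xprod S x" "xprod S (tauv i j x) = xprod S x"
    "xprod S (sign_change {i} x) = xprod S x"
  using assms by (auto intro!: xprod_cong simp: swapv_nth tauv_nth sign_change_def)

text \<open>Since \<open>x_i^2 - x_j^2\<close> is the product of both root functionals, dividing by
  one leaves the other as a factor, and the two leftover factors add up to \<open>2 x_i\<close>. The
  monomial is untouched by the reflections. This lemma and the next three distinguish whether
  \<open>i\<close> and \<open>j\<close> lie in the index set of the monomial.\<close>

lemma quotients_xprod_sqv_neither:
  fixes G :: "real ^ 'n::finite \<Rightarrow> complex" and c :: complex
  assumes G: "smooth G" and ij: "i \<noteq> j" and S: "i \<notin> S" "j \<notin> S"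
  defines "F \<equiv> \<lambda>x. c * xprod S x * G (sqv x)"
  shows "swap_quot i j F x + tau_quot i j F x = 2 * c * xprod S x * complex_of_real (x $ i) * swap_quot i j G (sqv x)"
proof -
  note Q = smooth_swap_quot[OF G ij]
  have Gs: "G (swapv i j y) = G y - complex_of_real (y $ i - y $ j) * swap_quot i j G y" for y
    using Q(2)[of y] by (simp add: algebra_simps)
  have "swap_quot i j F = (\<lambda>x. c * xprod S x * complex_of_real (x $ i + x $ j) * swap_quot i j G (sqv x))"
    by (rule swap_quot_eqI[OF ij])
       (auto intro!: continuous_intros continuous_on_smooth[OF Q(1)]
         simp: F_def sqv_swapv Gs xprod_reflect_out S algebra_simps power2_eq_square)
  moreover have "tau_quot i j F = (\<lambda>x. c * xprod S x * complex_of_real (x $ i - x $ j) * swap_quot i j G (sqv x))"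
    by (rule tau_quot_eqI[OF ij])
       (auto intro!: continuous_intros continuous_on_smooth[OF Q(1)]
         simp: F_def sqv_tauv Gs xprod_reflect_out S algebra_simps power2_eq_square)
  ultimately show ?thesis by (simp add: algebra_simps)
qed

text \<open>The product \<open>x_i x_j\<close> is invariant under both reflections, as the two signs
  of \<open>tauv\<close> cancel, so the result is the same as when neither index occurs.\<close>

lemma quotients_xprod_sqv_both:
  fixes G :: "real ^ 'n::finite \<Rightarrow> complex" and c :: complex
  assumes G: "smooth G" and ij: "i \<noteq> j" and S: "i \<in> S" "j \<in> S"
  defines "F \<equiv> \<lambda>x. c * xprod S x * G (sqv x)"
  shows "swap_quot i j F x + tau_quot i j F x = 2 * c * xprod S x * complex_of_real (x $ i) * swap_quot i j G (sqv x)"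
proof -
  note Q = smooth_swap_quot[OF G ij]
  have Gs: "G (swapv i j y) = G y - complex_of_real (y $ i - y $ j) * swap_quot i j G y" for y
    using Q(2)[of y] by (simp add: algebra_simps)
  define S' where "S' = S - {i, j}"
  have SS: "S = insert i (insert j S')" "i \<notin> S'" "j \<notin> S'" using S by (auto simp: S'_def)
  have X: "xprod S (swapv i j x) = xprod S x" "xprod S (tauv i j x) = xprod S x" for x
    using SS ij by (simp_all add: xprod_insert xprod_reflect_out swapv_nth tauv_nth)
  have "swap_quot i j F = (\<lambda>x. c * xprod S x * complex_of_real (x $ i + x $ j) * swap_quot i j G (sqv x))"
    by (rule swap_quot_eqI[OF ij])
       (auto intro!: continuous_intros continuous_on_smooth[OF Q(1)]
         simp: F_def sqv_swapv Gs X algebra_simps power2_eq_square)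
  moreover have "tau_quot i j F = (\<lambda>x. c * xprod S x * complex_of_real (x $ i - x $ j) * swap_quot i j G (sqv x))"
    by (rule tau_quot_eqI[OF ij])
       (auto intro!: continuous_intros continuous_on_smooth[OF Q(1)]
         simp: F_def sqv_tauv Gs X algebra_simps power2_eq_square)
  ultimately show ?thesis by (simp add: algebra_simps)
qed

text \<open>The factor \<open>x_j\<close> becomes \<open>x_i\<close> under the swap and
  \<open>- x_i\<close> under \<open>tauv\<close>. The resulting extra terms in \<open>G\<close> have
  opposite signs and cancel in the sum.\<close>

lemma quotients_xprod_sqv_second:
  fixes G :: "real ^ 'n::finite \<Rightarrow> complex" and c :: complex
  assumes G: "smooth G" and ij: "i \<noteq> j" and S: "i \<notin> S" "j \<in> S"
  defines "F \<equiv> \<lambda>x. c * xprod S x * G (sqv x)"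
  shows "swap_quot i j F x + tau_quot i j F x = 2 * c * xprod S x * complex_of_real (x $ i) * swap_quot i j G (sqv x)"
proof -
  note Q = smooth_swap_quot[OF G ij]
  have Gs: "G (swapv i j y) = G y - complex_of_real (y $ i - y $ j) * swap_quot i j G y" for y
    using Q(2)[of y] by (simp add: algebra_simps)
  define S' where "S' = S - {j}"
  have SS: "S = insert j S'" "i \<notin> S'" "j \<notin> S'" using S by (auto simp: S'_def)
  have S_eq: "xprod S x = complex_of_real (x $ j) * xprod S' x" for x
    using SS by (simp add: xprod_insert)
  note X = S_eq xprod_reflect_out(1,2)[OF SS(2,3)] swapv_nth[of i j _ j] tauv_nth[of i j _ j] ij[symmetric]
  have "swap_quot i j F = (\<lambda>x. c * xprod S' x *
      (complex_of_real (x $ i * (x $ i + x $ j)) * swap_quot i j G (sqv x) - G (sqv x)))"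
    by (rule swap_quot_eqI[OF ij])
       (auto intro!: continuous_intros continuous_on_smooth[OF Q(1)] continuous_on_smooth[OF G]
         simp: F_def sqv_swapv Gs X algebra_simps power2_eq_square)
  moreover have "tau_quot i j F = (\<lambda>x. c * xprod S' x *
      (G (sqv x) - complex_of_real (x $ i * (x $ i - x $ j)) * swap_quot i j G (sqv x)))"
    by (rule tau_quot_eqI[OF ij])
       (auto intro!: continuous_intros continuous_on_smooth[OF Q(1)] continuous_on_smooth[OF G]
         simp: F_def sqv_tauv Gs X algebra_simps power2_eq_square)
  ultimately show ?thesis by (simp add: algebra_simps S_eq)
qed

text \<open>Here the factor \<open>x_i\<close> is replaced by plus or minus \<open>x_j\<close>, and
  both quotients leave the same extra term, \<open>G\<close> at the swapped point. This is where the
  reflection sum in \<open>dunkl_shift\<close> comes from. Accordingly \<open>G\<close> is expressed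
  through its reflected value, and not conversely as in the other cases.\<close>

lemma quotients_xprod_sqv_first:
  fixes G :: "real ^ 'n::finite \<Rightarrow> complex" and c :: complex
  assumes G: "smooth G" and S: "i \<notin> S" "j \<notin> insert i S"
  defines "F \<equiv> \<lambda>x. c * xprod (insert i S) x * G (sqv x)"
  shows "swap_quot i j F x + tau_quot i j F x = 2 * c * xprod S x *
    ((complex_of_real (x $ i))\<^sup>2 * swap_quot i j G (sqv x) + G (swapv i j (sqv x)))"
proof -
  have ij: "i \<noteq> j" and j: "j \<notin> S" using S by auto
  note Q = smooth_swap_quot[OF G ij]
  have Gs: "G y = G (swapv i j y) + complex_of_real (y $ i - y $ j) * swap_quot i j G y" for y
    using Q(2)[of y] by (simp add: algebra_simps)
  note X = xprod_insert[OF S(1)] xprod_reflect_out(1,2)[OF S(1) j] swapv_nth[of i j _ i] tauv_nth[of i j _ i]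
  have e1: "c * xprod (insert i S) y * G (sqv y) - c * xprod (insert i S) (swapv i j y) * G (swapv i j (sqv y))
    = complex_of_real (y $ i - y $ j) * (c * xprod S y *
      (complex_of_real (y $ i * (y $ i + y $ j)) * swap_quot i j G (sqv y) + G (swapv i j (sqv y))))" for y
    by (subst Gs) (simp add: X algebra_simps power2_eq_square)
  have e2: "c * xprod (insert i S) y * G (sqv y) - c * xprod (insert i S) (tauv i j y) * G (swapv i j (sqv y))
    = complex_of_real (y $ i + y $ j) * (c * xprod S y *
      (complex_of_real (y $ i * (y $ i - y $ j)) * swap_quot i j G (sqv y) + G (swapv i j (sqv y))))" for y
    by (subst Gs) (simp add: X algebra_simps power2_eq_square)
  have "swap_quot i j F = (\<lambda>x. c * xprod S x *
      (complex_of_real (x $ i * (x $ i + x $ j)) * swap_quot i j G (sqv x) + G (swapv i j (sqv x))))"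
    using e1 by (intro swap_quot_eqI[OF ij])
       (auto intro!: continuous_intros continuous_on_smooth[OF Q(1)] continuous_on_smooth[OF G]
         simp: F_def sqv_swapv)
  moreover have "tau_quot i j F = (\<lambda>x. c * xprod S x *
      (complex_of_real (x $ i * (x $ i - x $ j)) * swap_quot i j G (sqv x) + G (swapv i j (sqv x))))"
    using e2 by (intro tau_quot_eqI[OF ij])
       (auto intro!: continuous_intros continuous_on_smooth[OF Q(1)] continuous_on_smooth[OF G]
         simp: F_def sqv_tauv)
  ultimately show ?thesis by (simp add: algebra_simps power2_eq_square)
qed

text \<open>The function is even in coordinate \<open>i\<close>, so the term with \<open>k'\<close>
  vanishes; the remaining terms share the factor \<open>2 x_i\<close>, which extends the
  monomial.\<close>

lemma dunklB_xprod_sqv_out: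
  fixes G :: "real ^ 'n::finite \<Rightarrow> complex"
  assumes G: "smooth G" and i: "i \<notin> S"
  shows "dunklB k k' i (\<lambda>x. c * xprod S x * G (sqv x)) =
    (\<lambda>x. c * 2 * xprod (insert i S) x * dunklA k i G (sqv x))"
proof
  fix x
  let ?F = "\<lambda>x. c * xprod S x * G (sqv x)"
  have "sign_quot i ?F = (\<lambda>x. 0)"
    by (rule sign_quot_eqI) (use i in \<open>auto simp: sqv_sign_change xprod_reflect_out\<close>)
  moreover have "swap_quot i j ?F x + tau_quot i j ?F x =
      2 * c * xprod S x * complex_of_real (x $ i) * swap_quot i j G (sqv x)" if "j \<in> UNIV - {i}" for j
    using that quotients_xprod_sqv_neither[OF G _ i] quotients_xprod_sqv_second[OF G _ i]
    by (cases "j \<in> S") auto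
  then have "(\<Sum>j\<in>UNIV - {i}. swap_quot i j ?F x + tau_quot i j ?F x) =
      2 * c * xprod S x * complex_of_real (x $ i) * (\<Sum>j\<in>UNIV - {i}. swap_quot i j G (sqv x))"
    unfolding sum_distrib_left by (rule sum.cong[OF refl])
  ultimately show "dunklB k k' i ?F x = c * 2 * xprod (insert i S) x * dunklA k i G (sqv x)"
    unfolding dunklB_def dunklA_def
    by (simp only: partial_xprod_sqv_out[OF G i] xprod_insert[OF i]) (simp add: algebra_simps)
qed

text \<open>Differentiating the factor \<open>x_i\<close> contributes \<open>G\<close> and the sign
  change contributes \<open>2 k' G\<close>. With the common factor 2 taken out this is the constant
  \<open>k' + 1/2\<close>.\<close>

lemma dunklB_xprod_sqv_in:
  fixes G :: "real ^ 'n::finite \<Rightarrow> complex"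
  assumes G: "smooth G" and i: "i \<notin> S"
  shows "dunklB k k' i (\<lambda>x. c * xprod (insert i S) x * G (sqv x)) =
    (\<lambda>x. c * 2 * xprod S x * dunkl_shift (k' + 1/2) k (- insert i S) i G (sqv x))"
proof
  fix x
  let ?F = "\<lambda>x. c * xprod (insert i S) x * G (sqv x)" and ?x = "complex_of_real (x $ i)"
  have "sign_quot i ?F = (\<lambda>x. 2 * c * xprod S x * G (sqv x))"
    by (rule sign_quot_eqI)
       (use i in \<open>auto simp: sqv_sign_change xprod_reflect_out(3) xprod_insert sign_change_nth algebra_simps
          intro!: continuous_intros continuous_on_smooth[OF G]\<close>)
  moreover have q: "swap_quot i j ?F x + tau_quot i j ?F x =
      2 * c * xprod S x * ?x\<^sup>2 * swap_quot i j G (sqv x) + 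
      (if j \<in> - insert i S then 2 * c * xprod S x * G (swapv i j (sqv x)) else 0)" if "j \<in> UNIV - {i}" for j
    using that quotients_xprod_sqv_both[OF G _, of i j "insert i S" c x] quotients_xprod_sqv_first[OF G i, of j c x]
    by (cases "j \<in> S") (auto simp: algebra_simps power2_eq_square xprod_insert[OF i])
  have "(\<Sum>j\<in>UNIV - {i}. swap_quot i j ?F x + tau_quot i j ?F x) =
     2 * c * xprod S x * (?x\<^sup>2 * (\<Sum>j\<in>UNIV - {i}. swap_quot i j G (sqv x)) + (\<Sum>j\<in>- insert i S. G (swapv i j (sqv x))))"
  proof -
    have "(\<Sum>j\<in>UNIV - {i}. if j \<in> - insert i S then 2 * c * xprod S x * G (swapv i j (sqv x)) else 0)
      = (\<Sum>j\<in>- insert i S. 2 * c * xprod S x * G (swapv i j (sqv x)))"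
      by (rule sum.mono_neutral_cong_right) auto
    then show ?thesis
      using sum.cong[OF refl q, of "UNIV - {i}"]
      by (simp add: sum.distrib distrib_left sum_distrib_left mult_ac)
  qed
  ultimately show "dunklB k k' i ?F x = c * 2 * xprod S x * dunkl_shift (k' + 1/2) k (- insert i S) i G (sqv x)"
    unfolding dunklB_def dunklA_def dunkl_shift_def
    by (simp only: partial_xprod_sqv_in[OF G i]) (simp add: algebra_simps power2_eq_square)
qed

lemma foldr_dunklB_up:
  fixes G :: "real ^ 'n::finite \<Rightarrow> complex"
  assumes "smooth G" "distinct xs"
  shows "smooth (foldr (dunklA k) xs G) \<and>
    foldr (dunklB k k') xs (\<lambda>x. G (sqv x)) =
      (\<lambda>x. 2 ^ length xs * xprod (set xs) x * foldr (dunklA k) xs G (sqv x))"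
  using assms(2)
proof (induction xs)
  case (Cons i xs)
  then show ?case
    by (simp add: dunklB_xprod_sqv_out smooth_dunklA mult.commute[of "2 ^ _" 2])
qed (simp add: assms)

text \<open>\<open>foldr\<close> applies the tail first, so the set attached to \<open>i\<close>
  consists of the coordinates whose operators have already acted.\<close>

fun dunkl_shifts :: "complex \<Rightarrow> real \<Rightarrow> 'n list \<Rightarrow> (real ^ 'n::finite \<Rightarrow> complex) \<Rightarrow> real ^ 'n \<Rightarrow> complex" where
  "dunkl_shifts a k [] G = G"
| "dunkl_shifts a k (i # xs) G = dunkl_shift a k (set xs) i (dunkl_shifts a k xs G)"

lemma smooth_dunkl_shifts: "smooth G \<Longrightarrow> smooth (dunkl_shifts a k xs G)"
  by (induction xs) (auto intro: smooth_dunkl_shift)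

text \<open>Starting from the full monomial, every operator removes its own coordinate; the
  coordinates missing from the monomial are then exactly those of the processed tail.\<close>

lemma foldr_dunklB_down:
  fixes G :: "real ^ 'n::finite \<Rightarrow> complex"
  assumes "smooth G" "distinct xs"
  shows "foldr (dunklB k k') xs (\<lambda>x. c * xprod UNIV x * G (sqv x)) =
      (\<lambda>x. c * 2 ^ length xs * xprod (- set xs) x * dunkl_shifts (k' + 1/2) k xs G (sqv x))"
  using assms(2)
proof (induction xs)
  case (Cons i xs)
  let ?S = "- set (i # xs)"
  have S: "- set xs = insert i ?S" "i \<notin> ?S" "- insert i ?S = set xs" using Cons.prems by auto
  show ?case
    using Cons dunklB_xprod_sqv_in[OF smooth_dunkl_shifts[OF assms(1)] S(2), of k k' "c * 2 ^ length xs" "k' + 1/2" k xs]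
    unfolding S(3) by (simp add: S(1) mult_ac del: set_simps)
qed simp

section \<open>Conjugation of type A Dunkl operators by powers of \<open>Delta\<close>\<close>

definition pos_orthant :: "(real ^ 'n::finite) set" where
  "pos_orthant = {y. \<forall>i. 0 < y $ i}"

lemma open_pos_orthant: "open (pos_orthant :: (real ^ 'n::finite) set)"
proof -
  have eq: "(pos_orthant :: (real ^ 'n) set) = (\<Inter>i. {y. 0 < y $ i})" by (auto simp: pos_orthant_def)
  show ?thesis
    unfolding eq by (intro open_INT finite ballI open_Collect_less continuous_intros)
qed

lemma swapv_pos_orthant: "y \<in> pos_orthant \<Longrightarrow> swapv i j y \<in> pos_orthant"
  by (auto simp: pos_orthant_def swapv_nth)

lemma Delta_pos: "y \<in> pos_orthant \<Longrightarrow> 0 < Delta y"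
  by (auto simp: pos_orthant_def Delta_def intro: prod_pos)

lemma xprod_nonzero: "y \<in> pos_orthant \<Longrightarrow> xprod M y \<noteq> 0"
  by (simp add: pos_orthant_def xprod_def less_imp_neq[symmetric])

lemma Delta_swapv: "Delta (swapv i j y) = Delta y"
  unfolding Delta_def swapv_def
  using prod.reindex_bij_betw[of "Transposition.transpose i j" UNIV UNIV "\<lambda>l. y $ l"]
  by (simp add: bij_betw_def)

lemma Delta_split: "Delta y = y $ i * (\<Prod>l\<in>UNIV - {i}. y $ l)"
  by (simp add: Delta_def prod.remove)

text \<open>\<open>Delta\<close> is invariant under swaps, so its power only contributes
  \<open>a / y_i\<close> through the derivative. The factor \<open>1 / y_M\<close> is constant in
  coordinate \<open>i\<close>; a swap with \<open>j\<close> in \<open>M\<close> turns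
  \<open>1 / y_j\<close> into \<open>1 / y_i\<close>, which produces the reflected value of
  \<open>G\<close> divided by \<open>y_i\<close>. Knowing \<open>H\<close> on the orthant suffices
  because the orthant is open and stable under swaps.\<close>

lemma dunklA_conjugated:
  fixes G H :: "real ^ 'n::finite \<Rightarrow> complex"
  assumes G: "smooth G" and i: "i \<notin> M" and y: "y \<in> pos_orthant"
    and H: "\<And>y. y \<in> pos_orthant \<Longrightarrow> H y = complex_of_real (Delta y) powr a / xprod M y * G y"
  shows "dunklA k i H y =
    complex_of_real (Delta y) powr a / xprod (insert i M) y * dunkl_shift a k M i G y"
proof -
  define W where "W = (\<lambda>y::real^'n. complex_of_real (Delta y) powr a)"
  have Wc: "continuous_on pos_orthant W"
  proof -
    have "continuous_on pos_orthant (\<lambda>y::real^'n. exp (a * complex_of_real (ln (Delta y))))"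
      unfolding Delta_def
      by (intro continuous_intros) (auto simp: pos_orthant_def less_imp_neq[symmetric])
    also have "?this \<longleftrightarrow> continuous_on pos_orthant W"
      by (rule continuous_on_cong) (auto simp: W_def powr_def Ln_of_real Delta_pos less_imp_neq[symmetric] dest!: Delta_pos)
    finally show ?thesis .
  qed
  have pos: "0 < y $ l" for l using y by (simp add: pos_orthant_def)
  have P: "partial i H y = W y / xprod M y * (a / complex_of_real (y $ i) * G y + partial i G y)"
  proof (rule partial_eqI)
    define C where "C = (\<Prod>l\<in>UNIV - {i}. y $ l)"
    have C: "0 < C" unfolding C_def by (rule prod_pos) (simp add: pos)
    have De: "Delta (y + t *\<^sub>R axis i 1) = (y $ i + t) * C" for t
      unfolding Delta_split[of _ i] C_def by (intro arg_cong2[of _ _ _ _ "(*)"] prod.cong) (auto simp: axis_def)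
    have D0: "Delta y = y $ i * C" unfolding Delta_split[of _ i] C_def ..
    have Xe: "xprod M (y + t *\<^sub>R axis i 1) = xprod M y" for t
      using i by (intro xprod_cong) (auto simp: axis_def)
    have "((\<lambda>t. complex_of_real ((y $ i + t) * C)) has_vector_derivative complex_of_real C) (at 0)"
      by (auto intro!: derivative_eq_intros has_vector_derivative_of_real simp flip: has_real_derivative_iff_has_vector_derivative)
    moreover have "((\<lambda>z. z powr a) has_field_derivative a * complex_of_real ((y $ i + 0) * C) powr (a - 1)) (at (complex_of_real ((y $ i + 0) * C)))"
      by (rule has_field_derivative_powr) (use mult_pos_pos[OF pos[of i] C] in \<open>simp add: complex_nonpos_Reals_iff del: of_real_mult\<close>)
    ultimately have "((\<lambda>t. complex_of_real ((y $ i + t) * C) powr a) has_vector_derivative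
        complex_of_real C * (a * complex_of_real ((y $ i + 0) * C) powr (a - 1))) (at 0)"
      using field_vector_diff_chain_at[of "\<lambda>t. complex_of_real ((y $ i + t) * C)" "complex_of_real C" 0 "\<lambda>z. z powr a"]
      by (simp add: o_def)
    moreover have "complex_of_real C * (a * complex_of_real ((y $ i + 0) * C) powr (a - 1)) = W y * (a / complex_of_real (y $ i))"
      using pos[of i] C by (simp add: W_def D0 powr_diff field_simps)
    ultimately have "((\<lambda>t. W (y + t *\<^sub>R axis i 1)) has_vector_derivative W y * (a / complex_of_real (y $ i))) (at 0)"
      by (simp add: W_def De)
    from has_vector_derivative_mult_right[OF has_vector_derivative_mult[OF this has_partial[OF smooth_differentiable[OF G], of y i]], of "1 / xprod M y"]
    have D: "((\<lambda>t. W (y + t *\<^sub>R axis i 1) / xprod M (y + t *\<^sub>R axis i 1) * G (y + t *\<^sub>R axis i 1)) has_vector_derivative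
       W y / xprod M y * (a / complex_of_real (y $ i) * G y + partial i G y)) (at 0)"
      unfolding Xe by (simp add: algebra_simps add_divide_distrib)
    show "((\<lambda>t. H (y + t *\<^sub>R axis i 1)) has_vector_derivative
       W y / xprod M y * (a / complex_of_real (y $ i) * G y + partial i G y)) (at 0)"
    \<comment> \<open>\<open>H\<close> is prescribed on the orthant only, so the derivative is
      transferred on the open set of \<open>t\<close> for which the line stays inside.\<close>
    proof (rule has_vector_derivative_transform_within_open[OF D])
      show "open ((\<lambda>t. y + t *\<^sub>R axis i 1) -` pos_orthant)"
        by (intro open_vimage open_pos_orthant continuous_intros)
    qed (use y in \<open>auto simp: H W_def\<close>)
  qed
  have Q: "swap_quot i j H y = W y / xprod M y *
       (swap_quot i j G y + (if j \<in> M then G (swapv i j y) / complex_of_real (y $ i) else 0))"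
    if ij: "i \<noteq> j" for j
  proof (cases "j \<in> M")
    case False
    have "swap_quot i j H y = W y / xprod M y * swap_quot i j G y"
    proof (rule dquot_eqI[OF linear_nth_diff[of i j], where v="axis i 1" and U=pos_orthant])
      fix z :: "real^'n" assume "z \<in> pos_orthant"
      then have "H z - H (swapv i j z) = W z / xprod M z * (G z - G (swapv i j z))"
        by (simp add: H swapv_pos_orthant Delta_swapv W_def xprod_reflect_out i False right_diff_distrib)
      then show "H z - H (swapv i j z) = complex_of_real (z $ i - z $ j) * (W z / xprod M z * swap_quot i j G z)"
        by (simp add: smooth_swap_quot(2)[OF G ij])
    next
      have "continuous_on pos_orthant (\<lambda>y. W y / xprod M y * swap_quot i j G y)"
        by (intro continuous_intros Wc continuous_on_smooth[OF smooth_swap_quot(1)[OF G ij]])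
           (auto simp: xprod_nonzero)
      then show "continuous (at y) (\<lambda>y. W y / xprod M y * swap_quot i j G y)"
        using y by (simp add: continuous_on_eq_continuous_at open_pos_orthant)
    qed (use y ij in \<open>auto simp: open_pos_orthant axis_def\<close>)
    with False show ?thesis by simp
  next
    case True
    define M' where "M' = M - {j}"
    have M: "M = insert j M'" "i \<notin> M'" "j \<notin> M'" using True i by (auto simp: M'_def)
    let ?q = "\<lambda>y. W y / xprod M y * (swap_quot i j G y + G (swapv i j y) / complex_of_real (y $ i))"
    have "swap_quot i j H y = ?q y"
    proof (rule dquot_eqI[OF linear_nth_diff[of i j], where v="axis i 1" and U=pos_orthant])
      fix z :: "real^'n" assume z: "z \<in> pos_orthant"
      have nz: "z $ i \<noteq> 0" "z $ j \<noteq> 0" "xprod M' z \<noteq> 0"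
        using z xprod_nonzero by (auto simp: pos_orthant_def less_imp_neq[symmetric])
      have X: "xprod M z = complex_of_real (z $ j) * xprod M' z"
        "xprod M (swapv i j z) = complex_of_real (z $ i) * xprod M' z"
        using M ij by (simp_all add: xprod_insert xprod_reflect_out swapv_nth)
      have Gz: "G z = G (swapv i j z) + complex_of_real (z $ i - z $ j) * swap_quot i j G z"
        using smooth_swap_quot(2)[OF G ij, of z] by (simp add: algebra_simps)
      have "H z - H (swapv i j z) = W z / xprod M z * G z - W z / xprod M (swapv i j z) * G (swapv i j z)"
        using z by (simp add: H swapv_pos_orthant Delta_swapv W_def)
      also have "\<dots> = complex_of_real (z $ i - z $ j) * ?q z"
        using nz unfolding X Gz by (simp add: field_simps)
      finally show "H z - H (swapv i j z) = complex_of_real (z $ i - z $ j) * ?q z" .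
    next
      have "continuous_on pos_orthant ?q"
        by (intro continuous_intros Wc continuous_on_smooth[OF smooth_swap_quot(1)[OF G ij]] continuous_on_smooth[OF G])
           (auto simp: xprod_nonzero pos_orthant_def less_imp_neq[symmetric])
      then show "continuous (at y) ?q"
        using y by (simp add: continuous_on_eq_continuous_at open_pos_orthant)
    qed (use y ij in \<open>auto simp: open_pos_orthant axis_def\<close>)
    with True show ?thesis by simp
  qed
  have "(\<Sum>j\<in>UNIV - {i}. swap_quot i j H y) =
    W y / xprod M y * ((\<Sum>j\<in>UNIV - {i}. swap_quot i j G y) + (\<Sum>j\<in>M. G (swapv i j y)) / complex_of_real (y $ i))"
  proof -
    have "(\<Sum>j\<in>UNIV - {i}. if j \<in> M then G (swapv i j y) / complex_of_real (y $ i) else 0)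
       = (\<Sum>j\<in>M. G (swapv i j y) / complex_of_real (y $ i))"
      using i by (intro sum.mono_neutral_cong_right) auto
    moreover have "(\<Sum>j\<in>UNIV - {i}. swap_quot i j H y) = (\<Sum>j\<in>UNIV - {i}. W y / xprod M y *
       (swap_quot i j G y + (if j \<in> M then G (swapv i j y) / complex_of_real (y $ i) else 0)))"
      by (rule sum.cong) (auto simp: Q)
    ultimately show ?thesis
      by (simp only: sum_distrib_left[symmetric] sum.distrib sum_divide_distrib)
  qed
  then show ?thesis
    using pos[of i] xprod_nonzero[OF y, of M]
    unfolding dunklA_def dunkl_shift_def P xprod_insert[OF i]
    by (simp add: field_simps flip: fun_cong[OF W_def])
qed

text \<open>The recursion runs through the same \<open>dunkl_shifts\<close> as
  \<open>foldr_dunklB_down\<close>; this coincidence is the heart of the operator identity.\<close>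

lemma foldr_dunklA_conjugated:
  fixes G H :: "real ^ 'n::finite \<Rightarrow> complex"
  assumes "smooth G" "distinct xs"
    and "\<And>y. y \<in> pos_orthant \<Longrightarrow> H y = complex_of_real (Delta y) powr a * G y"
  shows "y \<in> pos_orthant \<Longrightarrow> foldr (dunklA k) xs H y =
    complex_of_real (Delta y) powr a / xprod (set xs) y * dunkl_shifts a k xs G y"
  using assms(2)
proof (induction xs arbitrary: y)
  case (Cons i xs)
  then show ?case
    using dunklA_conjugated[OF smooth_dunkl_shifts[OF assms(1)], of i "set xs" y "foldr (dunklA k) xs H" a a k xs k]
    by simp
qed (simp add: assms)

lemma sqv_pos_orthant: "Delta x \<noteq> 0 \<Longrightarrow> sqv x \<in> pos_orthant"
  by (auto simp: pos_orthant_def Delta_def)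

text \<open>The first pass builds up the full monomial in front of \<open>g (sqv x)\<close>, the
  second removes it again, and each pass contributes \<open>2 ^ n\<close>. With
  \<open>a = k' + 1/2\<close> the second pass is the one obtained by conjugating with the power
  \<open>a\<close> of \<open>Delta\<close>.\<close>

lemma DeltaOp_dunklB_squared:
  fixes f0 :: "real ^ 'n::{finite,linorder} \<Rightarrow> complex" and \<nu> :: complex and k :: real
  defines "\<mu>0 \<equiv> k * (real CARD('n) - 1)"
  assumes f0: "smooth f0" and x: "Delta x \<noteq> 0"
  shows "DeltaOp (dunklB k (\<nu> - complex_of_real \<mu>0 - 1/2))
      (DeltaOp (dunklB k (\<nu> - complex_of_real \<mu>0 - 1/2)) (\<lambda>x. f0 (sqv x))) x = L_op k \<nu> f0 (sqv x)"
proof -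
  define xs where "xs = sorted_list_of_set (UNIV :: 'n set)"
  have xs: "distinct xs" "set xs = UNIV" "length xs = CARD('n)" by (auto simp: xs_def)
  define a where "a = \<nu> - complex_of_real \<mu>0"
  define g where "g = foldr (dunklA k) xs f0"
  note up = foldr_dunklB_up[OF f0 xs(1), of k "a - 1/2"]
  have y: "sqv x \<in> pos_orthant" (is "?y \<in> _") using x by (rule sqv_pos_orthant)
  have "foldr (dunklB k (a - 1/2)) xs (foldr (dunklB k (a - 1/2)) xs (\<lambda>x. f0 (sqv x))) x
     = 4 ^ CARD('n) * dunkl_shifts a k xs g ?y"
    using up foldr_dunklB_down[of g xs k "a - 1/2" "2 ^ CARD('n)"] xs
    by (simp add: g_def flip: power_mult_distrib)
  moreover have "L_op k \<nu> f0 ?y = 4 ^ CARD('n) * dunkl_shifts a k xs g ?y"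
  proof -
    let ?H = "Delta_pow_mult a g"
    have "foldr (dunklA k) xs ?H ?y = complex_of_real (Delta ?y) powr a / xprod UNIV ?y * dunkl_shifts a k xs g ?y"
      using foldr_dunklA_conjugated[of g xs ?H a ?y k] up xs y by (simp add: Delta_pow_mult_def g_def)
    \<comment> \<open>The two powers of \<open>Delta\<close> in \<open>L_op\<close> multiply to
      \<open>Delta\<close> itself, which cancels the division by \<open>xprod UNIV\<close>.\<close>
    moreover have "complex_of_real (Delta ?y) powr (1 - a) * complex_of_real (Delta ?y) powr a = complex_of_real (Delta ?y)"
      using Delta_pos[OF y] by (simp flip: powr_add)
    ultimately have "complex_of_real (Delta ?y) powr (1 - a) * foldr (dunklA k) xs ?H ?y = dunkl_shifts a k xs g ?y"
      using Delta_pos[OF y] by (simp add: xprod_UNIV flip: mult.assoc)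
    then show ?thesis
      by (simp add: L_op_def DeltaOp_def dimv_def Delta_pow_mult_def a_def g_def xs_def \<mu>0_def Let_def algebra_simps)
  qed
  ultimately show ?thesis
    by (simp add: DeltaOp_def a_def xs_def)
qed

section \<open>Weights and cut-offs for the extension\<close>

text \<open>The Taylor coefficients of Euler's product \<open>\<Prod>\<^sub>j (1 - z 4\<^sup>-\<^sup>j)\<close>, which vanishes at every \<open>z = 4\<^sup>m\<close>.\<close>

primrec euler_coeff :: "nat \<Rightarrow> real" where
  "euler_coeff 0 = 1"
| "euler_coeff (Suc k) = - (4 * euler_coeff k) / (4 ^ Suc k - 1)"

lemma four_power_gt_1: "(1::real) < 4 ^ Suc k"
  by (rule one_less_power) auto

lemma euler_coeff_rec: "euler_coeff (Suc k) * 4 ^ Suc k - euler_coeff (Suc k) = - 4 * euler_coeff k"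
proof -
  have "euler_coeff (Suc k) * (4 ^ Suc k - 1) = - 4 * euler_coeff k"
    using less_imp_neq[OF four_power_gt_1[of k], symmetric] by (simp del: power_Suc)
  then show ?thesis by (simp only: right_diff_distrib mult_1_right)
qed

text \<open>Consecutive terms have ratio \<open>4 ^ (m + 1) / (4 ^ (k + 1) - 1)\<close> in absolute
  value, which is at most 1/2 from \<open>k = m + 2\<close> on.\<close>

lemma summable_euler_coeff: "summable (\<lambda>k. \<bar>euler_coeff k\<bar> * 4 ^ (k * m))"
proof (rule summable_ratio_test[of "1/2" "m + 2"])
  fix k assume k: "k \<ge> m + 2"
  have "(4::real) ^ (m + 2) \<le> 4 ^ Suc k" using k by (intro power_increasing) auto
  then have "16 * (4::real) ^ m \<le> 4 ^ Suc k" by (simp add: power_add)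
  moreover have "(1::real) \<le> 4 ^ m" by simp
  ultimately have "8 * (4::real) ^ m \<le> 4 ^ Suc k - 1" by linarith
  then have "4 * 4 ^ m / ((4::real) ^ Suc k - 1) \<le> 1/2"
    using four_power_gt_1[of k] by (simp add: pos_divide_le_eq del: power_Suc)
  moreover have "norm (\<bar>euler_coeff (Suc k)\<bar> * 4 ^ (Suc k * m)) =
      4 * 4 ^ m / (4 ^ Suc k - 1) * norm (\<bar>euler_coeff k\<bar> * 4 ^ (k * m))"
    using four_power_gt_1[of k] by (simp add: abs_mult power_add abs_divide del: power_Suc)
  ultimately show "norm (\<bar>euler_coeff (Suc k)\<bar> * 4 ^ (Suc k * m)) \<le> 1/2 * norm (\<bar>euler_coeff k\<bar> * 4 ^ (k * m))"
    by (simp only:) (rule mult_right_mono, auto)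
qed simp

lemma summable_euler_coeff_mult:
  assumes "\<And>k. \<bar>r k\<bar> \<le> 4 ^ (k * m)"
  shows "summable (\<lambda>k. euler_coeff k * r k)"
  by (rule summable_rabs_cancel, rule summable_comparison_test'[OF summable_euler_coeff[of m], of 0])
     (auto simp: abs_mult intro: mult_left_mono assms)

text \<open>For the generating function \<open>E\<close> of the coefficients the recursion reads
  \<open>E(4 z) = (1 - 4 z) E(z)\<close>. Taking \<open>z = 1/4\<close> gives
  \<open>E(1) = 0\<close>, and taking \<open>z = 4 ^ m\<close> carries the zero from
  \<open>4 ^ m\<close> to \<open>4 ^ (m + 1)\<close>.\<close>

lemma euler_coeff_moments: "(\<Sum>k. euler_coeff k * 4 ^ (k * m)) = 0"
proof (induction m)
  case 0
  have s0: "summable euler_coeff" using summable_euler_coeff_mult[of "\<lambda>_. 1" 0] by simp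
  have sT: "summable (\<lambda>k. euler_coeff k / 4 ^ k)"
    using summable_euler_coeff_mult[of "\<lambda>k. 1 / 4 ^ k" 0] by simp
  have "euler_coeff (Suc k) = euler_coeff (Suc k) / 4 ^ Suc k - euler_coeff k / 4 ^ k" for k
    using euler_coeff_rec[of k] by (simp add: field_simps del: euler_coeff.simps)
  then have "(\<Sum>k. euler_coeff (Suc k)) = (\<Sum>k. euler_coeff (Suc k) / 4 ^ Suc k - euler_coeff k / 4 ^ k)"
    by presburger
  also have "\<dots> = (\<Sum>k. euler_coeff (Suc k) / 4 ^ Suc k) - (\<Sum>k. euler_coeff k / 4 ^ k)"
    by (intro suminf_diff[symmetric] sT) (subst summable_Suc_iff, rule sT)
  finally show ?case
    unfolding suminf_split_head[OF s0] suminf_split_head[OF sT] by simp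
next
  case (Suc m)
  let ?e = "\<lambda>m k. euler_coeff k * 4 ^ (k * m)"
  have s: "summable (?e m)" for m by (rule summable_euler_coeff_mult[where m=m]) simp
  have "?e (Suc m) (Suc k) = ?e m (Suc k) - 4 ^ Suc m * ?e m k" for k
  proof -
    have "?e (Suc m) (Suc k) - ?e m (Suc k) = (euler_coeff (Suc k) * 4 ^ Suc k - euler_coeff (Suc k)) * 4 ^ (Suc k * m)"
      by (simp add: algebra_simps power_add del: euler_coeff.simps)
    also have "\<dots> = - (4 ^ Suc m * ?e m k)" unfolding euler_coeff_rec by (simp add: power_add)
    finally show ?thesis by simp
  qed
  then have "(\<Sum>k. ?e (Suc m) (Suc k)) = (\<Sum>k. ?e m (Suc k) - 4 ^ Suc m * ?e m k)"
    by presburger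
  also have "\<dots> = (\<Sum>k. ?e m (Suc k)) - 4 ^ Suc m * (\<Sum>k. ?e m k)"
    unfolding suminf_mult[OF s, symmetric]
    by (intro suminf_diff[symmetric] summable_mult s) (subst summable_Suc_iff, rule s)
  finally show ?case
    unfolding suminf_split_head[OF s] using Suc.IH by (simp add: suminf_split_head[OF s])
qed

text \<open>Dividing the \<open>k\<close>-th coefficient by \<open>1 + 4\<^sup>k\<close> turns vanishing moments into moments that only alternate in sign.\<close>

lemma extension_weights_exist:
  obtains c :: "nat \<Rightarrow> real"
  where "\<And>m. summable (\<lambda>k. \<bar>c k * (- (4 ^ k)) ^ m\<bar>)" "\<And>m. (\<Sum>k. c k * (- (4 ^ k)) ^ m) = 1"
proof -
  define d where "d = (\<lambda>k. euler_coeff k / (1 + 4 ^ k))"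
  have abs_r: "\<bar>(- (4 ^ k)) ^ m / (1 + 4 ^ k)\<bar> \<le> (4::real) ^ (k * m)" for k m
  proof -
    have "(4::real) ^ (k * m) / (1 + 4 ^ k) \<le> 4 ^ (k * m) / 1" by (rule divide_left_mono) (auto simp: add_pos_pos)
    then show ?thesis by (simp add: abs_mult power_abs power_mult abs_divide)
  qed
  have sd: "summable (\<lambda>k. \<bar>d k * (- (4 ^ k)) ^ m\<bar>)" for m
    by (rule summable_comparison_test'[OF summable_euler_coeff[of m], of 0])
       (use mult_left_mono[OF abs_r, of "\<bar>euler_coeff _\<bar>"] in \<open>simp add: d_def abs_mult abs_divide\<close>)
  define M where "M m = (\<Sum>k. d k * (- (4 ^ k)) ^ m)" for m
  have "M (Suc m) = M m" for m
  proof -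
    have "d k * (- (4 ^ k)) ^ m - d k * (- (4 ^ k)) ^ Suc m = (-1) ^ m * (euler_coeff k * 4 ^ (k * m))" for k
    proof -
      have "d k * (- (4 ^ k)) ^ m - d k * (- (4 ^ k)) ^ Suc m = d k * (1 + 4 ^ k) * (- (4 ^ k)) ^ m"
        by (simp add: algebra_simps)
      also have "d k * (1 + 4 ^ k) = euler_coeff k"
        using zero_less_power[of "4::real" k] by (simp add: d_def add_nonneg_eq_0_iff)
      finally show ?thesis by (simp add: power_mult power_minus[of "4 ^ k"])
    qed
    then have "M m - M (Suc m) = (\<Sum>k. (-1) ^ m * (euler_coeff k * 4 ^ (k * m)))"
      unfolding M_def by (subst suminf_diff) (auto intro: summable_rabs_cancel sd simp del: power_Suc)
    also have "\<dots> = 0"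
      by (subst suminf_mult) (auto intro: summable_euler_coeff_mult simp: euler_coeff_moments)
    finally show ?thesis by simp
  qed
  then have MM: "M m = M 0" for m by (induction m) auto
  \<comment> \<open>The common value of the moments has to be nonzero to be normalised to 1. The
    term at index 0 is 1/2, and the others are dominated by a geometric series with ratio
    \<open>4/15 = 4 / (4^2 - 1)\<close> and sum \<open>4/11 < 1/2\<close>.\<close>
  have "M 0 \<noteq> 0"
  proof -
    have dS: "\<bar>d (Suc k)\<bar> \<le> (4/15) ^ Suc k" for k
    proof (induction k)
      case 0
      then show ?case by (simp add: d_def)
    next
      case (Suc k)
      have "(16::real) \<le> 4 ^ Suc (Suc k)" by simp
      then have "15 \<le> (4::real) ^ Suc (Suc k) - 1" by linarith
      then have 1: "4 / (4 ^ Suc (Suc k) - 1) \<le> (4/15::real)"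
        by (simp add: pos_divide_le_eq del: power_Suc)
      have 2: "inverse (1 + 4 ^ Suc (Suc k)) \<le> inverse (1 + 4 ^ Suc k :: real)"
        by (rule le_imp_inverse_le) (auto simp: add_pos_pos)
      have "d (Suc (Suc k)) = - (4 / (4 ^ Suc (Suc k) - 1)) * (euler_coeff (Suc k) * inverse (1 + 4 ^ Suc (Suc k)))"
        unfolding d_def euler_coeff.simps(2)[of "Suc k"]
        by (simp add: divide_inverse mult_ac del: power_Suc euler_coeff.simps)
      then have "\<bar>d (Suc (Suc k))\<bar> = 4 / (4 ^ Suc (Suc k) - 1) * (\<bar>euler_coeff (Suc k)\<bar> * inverse (1 + 4 ^ Suc (Suc k)))"
        using four_power_gt_1[of "Suc k"]
        by (simp add: abs_mult abs_divide del: power_Suc euler_coeff.simps)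
      also have "\<dots> \<le> 4/15 * (\<bar>euler_coeff (Suc k)\<bar> * inverse (1 + 4 ^ Suc k))"
        by (intro mult_mono 1 2 mult_left_mono) (auto simp del: power_Suc)
      also have "\<bar>euler_coeff (Suc k)\<bar> * inverse (1 + 4 ^ Suc k) = \<bar>d (Suc k)\<bar>"
        by (simp add: d_def abs_divide field_simps del: power_Suc euler_coeff.simps)
      also have "4/15 * \<bar>d (Suc k)\<bar> \<le> 4/15 * (4/15) ^ Suc k" using Suc.IH by simp
      finally show ?case by simp
    qed
    have gs: "(\<lambda>k. (4/15::real) ^ Suc k) sums (4/11)"
      using sums_mult[OF geometric_sums[of "4/15::real"], of "4/15"] by simp
    have sd0: "summable d" using summable_rabs_cancel[OF sd[of 0]] by simp
    have "summable (\<lambda>k. \<bar>d (Suc k)\<bar>)"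
      by (rule summable_comparison_test'[OF sums_summable[OF gs], of 0]) (use dS in auto)
    then have "\<bar>\<Sum>k. d (Suc k)\<bar> \<le> (\<Sum>k. \<bar>d (Suc k)\<bar>)" by (rule summable_rabs)
    also have "\<dots> \<le> (\<Sum>k. (4/15) ^ Suc k)"
      by (rule suminf_le) (use dS \<open>summable (\<lambda>k. \<bar>d (Suc k)\<bar>)\<close> sums_summable[OF gs] in auto)
    also have "\<dots> = 4/11" using gs by (rule sums_unique[symmetric])
    finally have "\<bar>\<Sum>k. d (Suc k)\<bar> \<le> 4/11" .
    moreover have "M 0 = (\<Sum>k. d (Suc k)) + 1/2"
      unfolding M_def using suminf_split_head[OF sd0] by (simp add: d_def)
    ultimately show ?thesis by linarith
  qed
  define c where "c = (\<lambda>k. d k / M 0)"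
  have "summable (\<lambda>k. \<bar>c k * (- (4 ^ k)) ^ m\<bar>)" for m
    using summable_divide[OF sd[of m], of "\<bar>M 0\<bar>"] by (simp add: c_def abs_mult abs_divide)
  moreover have "(\<Sum>k. c k * (- (4 ^ k)) ^ m) = 1" for m
  proof -
    have "(\<Sum>k. c k * (- (4 ^ k)) ^ m) = M m / M 0"
      using suminf_divide[OF summable_rabs_cancel[OF sd[of m]], of "M 0"] by (simp add: c_def M_def[of m])
    then show ?thesis using MM[of m] \<open>M 0 \<noteq> 0\<close> by simp
  qed
  ultimately show ?thesis by (rule that)
qed

section \<open>A smooth cut-off in one coordinate\<close>

definition flat :: "nat \<Rightarrow> real \<Rightarrow> real" where
  "flat k x = (if 0 < x then inverse x ^ k * exp (- inverse x) else 0)"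

lemma flat_tendsto_0: "(flat k \<longlongrightarrow> 0) (at 0)"
proof -
  have "((\<lambda>x. inverse x ^ k / exp (inverse x)) \<longlongrightarrow> (0::real)) (at_right 0)"
    by (rule filterlim_compose[OF tendsto_power_div_exp_0 filterlim_inverse_at_top_right])
  then have "(flat k \<longlongrightarrow> 0) (at_right 0)"
    by (rule Lim_transform_eventually)
       (auto simp: flat_def eventually_at_filter exp_minus field_simps)
  moreover have "(flat k \<longlongrightarrow> 0) (at_left 0)"
    by (rule Lim_transform_eventually[OF tendsto_const]) (auto simp: flat_def eventually_at_filter)
  ultimately show ?thesis by (simp add: filterlim_at_split)
qed

text \<open>The power of \<open>inverse x\<close> in \<open>flat\<close> makes the family closed
  under differentiation. At 0 the difference quotient of \<open>flat k\<close> is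
  \<open>flat (Suc k)\<close>, which tends to 0.\<close>

lemma flat_deriv: "(flat k has_real_derivative flat (k + 2) x - real k * flat (k + 1) x) (at x)"
proof -
  consider "x < 0" | "x = 0" | "0 < x" by linarith
  then show ?thesis
  proof cases
    case 1
    have "((\<lambda>x. 0::real) has_real_derivative 0) (at x)" by simp
    then have "(flat k has_real_derivative 0) (at x)"
      by (rule has_field_derivative_transform_within_open[where S="{..<0}"])
         (use 1 in \<open>auto simp: flat_def\<close>)
    with 1 show ?thesis by (simp add: flat_def)
  next
    case 2
    have "((\<lambda>h. (flat k (0 + h) - flat k 0) / h) \<longlongrightarrow> 0) (at 0)"
      by (rule Lim_transform_eventually[OF flat_tendsto_0[of "Suc k"]])
         (auto simp: flat_def eventually_at_filter field_simps)
    then have "(flat k has_real_derivative 0) (at 0)" by (simp add: DERIV_def)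
    with 2 show ?thesis by (simp add: flat_def)
  next
    case 3
    have "((\<lambda>x. inverse x ^ k * exp (- inverse x)) has_real_derivative
        real k * (inverse x ^ (k - 1) * - (inverse x * inverse x)) * exp (- inverse x)
        + inverse x ^ k * (exp (- inverse x) * (inverse x * inverse x))) (at x)"
      using 3 by (auto intro!: derivative_eq_intros simp: algebra_simps)
    \<comment> \<open>The subtraction \<open>k - 1\<close> truncates only at \<open>k = 0\<close>,
      where the factor \<open>real k\<close> kills the term.\<close>
    also have "real k * (inverse x ^ (k - 1) * - (inverse x * inverse x)) * exp (- inverse x)
        + inverse x ^ k * (exp (- inverse x) * (inverse x * inverse x)) =
        flat (k + 2) x - real k * flat (k + 1) x"
      using 3 by (cases k) (auto simp: flat_def algebra_simps)
    finally show ?thesis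
      by (rule has_field_derivative_transform_within_open[where S="{0<..}"])
         (use 3 in \<open>auto simp: flat_def\<close>)
  qed
qed

lemma smooth_flat:
  fixes u :: "real ^ 'n::finite \<Rightarrow> real"
  assumes "smooth (\<lambda>x. complex_of_real (u x))"
  shows "smooth (\<lambda>x. complex_of_real (flat k (u x)))"
proof -
  let ?U = "\<lambda>x. complex_of_real (u x)"
  have dU: "?U differentiable (at x)" for x using assms by (rule smooth_differentiable)
  have "diffN m (\<lambda>x. complex_of_real (flat k (u x)))" for m k
  proof (induction m arbitrary: k)
    case (Suc m)
    have D: "((\<lambda>x. complex_of_real (flat k (u x))) has_derivative
       (\<lambda>v. (\<Sum>i\<in>UNIV. complex_of_real (v $ i) * partial i ?U x) * complex_of_real (flat (k + 2) (u x) - real k * flat (k + 1) (u x)))) (at x)" for x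
    proof -
      let ?D = "\<lambda>v. \<Sum>i\<in>UNIV. complex_of_real (v $ i) * partial i ?U x"
      let ?f' = "flat (k + 2) (u x) - real k * flat (k + 1) (u x)"
      have 1: "(?U has_derivative ?D) (at x)" by (rule has_derivative_partials[OF dU])
      then have u: "(u has_derivative (\<lambda>v. Re (?D v))) (at x)"
        using bounded_linear.has_derivative[OF bounded_linear_Re 1] by simp
      have "?D = (\<lambda>v. complex_of_real (Re (?D v)))"
        by (rule has_derivative_unique[OF 1 has_derivative_of_real[OF u]])
      then have r: "?D v = complex_of_real (Re (?D v))" for v by metis
      have "((\<lambda>x. flat k (u x)) has_derivative (\<lambda>v. Re (?D v) * ?f')) (at x)"
        using DERIV_compose_FDERIV[OF flat_deriv u] by simp
      from has_derivative_of_real[OF this] show ?thesis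
        by (subst r) (simp only: of_real_mult)
    qed
    have "(\<Sum>l\<in>UNIV. complex_of_real (axis i 1 $ l) * partial l ?U x) = (\<Sum>l\<in>UNIV. if l = i then partial l ?U x else 0)" for i x
      by (intro sum.cong) (auto simp: axis_def)
    then have "partial i (\<lambda>x. complex_of_real (flat k (u x))) =
      (\<lambda>x. partial i ?U x * (complex_of_real (flat (k + 2) (u x)) + complex_of_real (- real k) * complex_of_real (flat (k + 1) (u x))))" for i
      by (intro ext) (simp add: partial_eq_derivative[OF D])
    moreover have "diffN m (partial i ?U)" for i
      using smooth_partial[OF assms] smooth_iff_diffN by blast
    ultimately have "diffN m (partial i (\<lambda>x. complex_of_real (flat k (u x))))" for i
      by (simp only:) (intro diffN_mult diffN_add diffN_const Suc.IH)
    moreover have "(\<lambda>x. complex_of_real (flat k (u x))) differentiable (at x)" for x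
      using D differentiable_def by blast
    ultimately show ?case by simp
  qed simp
  then show ?thesis by (simp add: smooth_iff_diffN)
qed

lemma smooth_inverse: "(\<And>x. g x \<noteq> 0) \<Longrightarrow> smooth g \<Longrightarrow> smooth (\<lambda>x. inverse (g x))"
  by (simp add: smooth_iff_diffN diffN_inverse)

text \<open>With \<open>s = x $ i\<close>, the function is the quotient of
  \<open>flat 0 (2 - s^2)\<close> by its sum with \<open>flat 0 (s^2 - 1)\<close>. The two summands
  never vanish together, the second vanishes for \<open>s^2 \<le> 1\<close> and the first for
  \<open>s^2 \<ge> 2\<close>.\<close>

lemma smooth_cutoff:
  fixes i :: "'n::finite"
  obtains \<theta> :: "real ^ 'n \<Rightarrow> complex"
  where "smooth \<theta>" "\<And>x. \<bar>x $ i\<bar> < 1 \<Longrightarrow> \<theta> x = 1" "\<And>x. 2 < \<bar>x $ i\<bar> \<Longrightarrow> \<theta> x = 0"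
    "\<And>x y. \<bar>x $ i\<bar> = \<bar>y $ i\<bar> \<Longrightarrow> \<theta> x = \<theta> y"
proof -
  define h where "h = (\<lambda>x::real^'n. complex_of_real (flat 0 (2 - (x $ i)\<^sup>2)))"
  define d where "d = (\<lambda>x::real^'n. h x + complex_of_real (flat 0 ((x $ i)\<^sup>2 - 1)))"
  have n: "smooth (\<lambda>x::real^'n. complex_of_real (x $ i) * complex_of_real (x $ i))"
    by (intro smooth_mult smooth_nth)
  have sh: "smooth h" unfolding h_def
    by (rule smooth_flat) (use smooth_diff[OF smooth_const[of 2] n] in \<open>simp add: power2_eq_square\<close>)
  have sd: "smooth d" unfolding d_def
    by (intro smooth_add sh smooth_flat) (use smooth_diff[OF n smooth_const[of 1]] in \<open>simp add: power2_eq_square\<close>)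
  have nz: "d x \<noteq> 0" for x
  proof -
    have "0 < flat 0 (2 - (x $ i)\<^sup>2) + flat 0 ((x $ i)\<^sup>2 - 1)"
      by (auto simp: flat_def add_pos_pos)
    then show ?thesis
      unfolding d_def h_def of_real_add[symmetric] of_real_eq_0_iff by simp
  qed
  show ?thesis
  proof (rule that[of "\<lambda>x. h x * inverse (d x)"])
    show "smooth (\<lambda>x. h x * inverse (d x))" by (intro smooth_mult sh smooth_inverse nz sd)
    show "h x * inverse (d x) = 1" if "\<bar>x $ i\<bar> < 1" for x
    proof -
      have "(x $ i)\<^sup>2 < 1" using that by (simp add: abs_square_less_1)
      then have "d x = h x" by (simp add: d_def flat_def)
      with nz[of x] show ?thesis by simp
    qed
    show "h x * inverse (d x) = 0" if "2 < \<bar>x $ i\<bar>" for x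
    proof -
      have "2\<^sup>2 < \<bar>x $ i\<bar>\<^sup>2" by (rule power_strict_mono) (use that in auto)
      then show ?thesis by (simp add: h_def flat_def)
    qed
    show "h x * inverse (d x) = h y * inverse (d y)" if "\<bar>x $ i\<bar> = \<bar>y $ i\<bar>" for x y
    proof -
      have "(x $ i)\<^sup>2 = (y $ i)\<^sup>2" using that by (metis power2_abs)
      then show ?thesis by (simp add: h_def d_def)
    qed
  qed
qed

section \<open>Whitney's theorem on even functions\<close>

definition put :: "'n::finite \<Rightarrow> real ^ 'n \<Rightarrow> real \<Rightarrow> real ^ 'n" where
  "put i x s = (\<chi> l. if l = i then s else x $ l)"

lemma put_nth: "put i x s $ l = (if l = i then s else x $ l)"
  by (simp add: put_def)

lemma put_same [simp]: "put i x (x $ i) = x"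
  by (simp add: vec_eq_iff put_nth)

lemma put_put [simp]: "put i (put i x s) t = put i x t"
  by (simp add: vec_eq_iff put_nth)

lemma put_nth_same [simp]: "put i x s $ i = s"
  by (simp add: put_nth)

lemma put_uminus: "put i x (- s) = sign_change {i} (put i x s)"
  by (simp add: vec_eq_iff put_nth sign_change_nth)

lemma put_add: "put i x (s + t) = put i x s + t *\<^sub>R axis i 1"
  by (simp add: vec_eq_iff put_nth axis_def)

lemma put_add_other: "j \<noteq> i \<Longrightarrow> put i (x + t *\<^sub>R axis j 1) s = put i x s + t *\<^sub>R axis j 1"
  by (simp add: vec_eq_iff put_nth axis_def)

lemma continuous_on_put [continuous_intros]:
  assumes "continuous_on A h" "continuous_on A s"
  shows "continuous_on A (\<lambda>x. put i (h x) (s x))"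
  unfolding put_def
proof (rule continuous_on_vec_lambda)
  fix l
  show "continuous_on A (\<lambda>x. if l = i then s x else h x $ l)"
    by (cases "l = i") (auto intro!: continuous_intros assms)
qed

section \<open>Parity in one coordinate and the halved quotient of the derivative\<close>

definition even_in :: "'n \<Rightarrow> (real ^ 'n::finite \<Rightarrow> complex) \<Rightarrow> bool" where
  "even_in i f \<longleftrightarrow> (\<forall>x. f (sign_change {i} x) = f x)"

lemma even_in_abs: "even_in i f \<Longrightarrow> f (put i x \<bar>s\<bar>) = f (put i x s)"
  by (cases "s \<ge> 0") (auto simp: even_in_def put_uminus)

lemma partial_cong_open:
  assumes "open U" "x \<in> U" "\<And>y. y \<in> U \<Longrightarrow> f y = g y" "smooth f"
  shows "partial i f x = partial i g x"
proof (rule sym, rule partial_eqI)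
  show "((\<lambda>t. g (x + t *\<^sub>R axis i 1)) has_vector_derivative partial i f x) (at 0)"
  proof (rule has_vector_derivative_transform_within_open[OF has_partial[OF smooth_differentiable[OF assms(4)]]])
    show "open ((\<lambda>t. x + t *\<^sub>R axis i 1) -` U)"
      by (intro open_vimage assms continuous_intros)
  qed (use assms in auto)
qed

lemma partial_sign_change:
  assumes f: "smooth f" and ev: "even_in j f"
  shows "partial i f (sign_change {j} x) = (if i = j then - partial i f x else partial i f x)"
proof (rule partial_eqI)
  define s :: real where "s = (if i = j then -1 else 1)"
  have e: "f (sign_change {j} x + t *\<^sub>R axis i 1) = f (x + (s * t) *\<^sub>R axis i 1)" for t
  proof -
    have "sign_change {j} x + t *\<^sub>R axis i 1 = sign_change {j} (x + (s * t) *\<^sub>R axis i 1)"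
      by (auto simp: vec_eq_iff sign_change_nth s_def axis_def)
    then show ?thesis using ev by (simp add: even_in_def)
  qed
  have "((\<lambda>t. s * t) has_vector_derivative s) (at 0)"
    by (auto intro!: derivative_eq_intros simp flip: has_real_derivative_iff_has_vector_derivative)
  from vector_diff_chain_at[OF this, of "\<lambda>t. f (x + t *\<^sub>R axis i 1)"]
    has_partial[OF smooth_differentiable[OF f], of x i]
  have "((\<lambda>t. f (sign_change {j} x + t *\<^sub>R axis i 1)) has_vector_derivative s *\<^sub>R partial i f x) (at 0)"
    by (simp add: o_def e)
  also have "s *\<^sub>R partial i f x = (if i = j then - partial i f x else partial i f x)"
    by (simp add: s_def)
  finally show "((\<lambda>t. f (sign_change {j} x + t *\<^sub>R axis i 1)) has_vector_derivative
      (if i = j then - partial i f x else partial i f x)) (at 0)" .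
qed

text \<open>The partial is odd in coordinate \<open>i\<close>, so its difference under the sign
  change is twice itself, and Hadamard's quotient \<open>q\<close> of that difference gives
  \<open>e = q / 4\<close>. Evenness follows by division off the hyperplane, while points on it are
  fixed by the sign change.\<close>

lemma half_quotient_exists:
  assumes f: "smooth f" and ev: "even_in i f"
  shows "\<exists>e. smooth e \<and> even_in i e \<and> (\<forall>x. partial i f x = 2 * complex_of_real (x $ i) * e x)"
proof -
  obtain q where q: "smooth q"
    "\<And>y. partial i f y - partial i f (y - (y $ i) *\<^sub>R (2 *\<^sub>R axis i 1)) = complex_of_real (y $ i) * q y"
    using reflection_quotient_exists[OF smooth_partial[OF f] linear_nth] by metis
  have "y - (y $ i) *\<^sub>R (2 *\<^sub>R axis i 1) = sign_change {i} y" for y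
    by (auto simp: vec_eq_iff sign_change_nth axis_def)
  with q(2) have "2 * partial i f y = complex_of_real (y $ i) * q y" for y
    by (simp add: partial_sign_change[OF f ev])
  then have p: "partial i f y = 2 * complex_of_real (y $ i) * (1/4 * q y)" for y
    by (simp add: field_simps)
  have "1/4 * q (sign_change {i} y) = 1/4 * q y" for y
  proof (cases "y $ i = 0")
    case True
    then have "sign_change {i} y = y" by (simp add: vec_eq_iff sign_change_nth)
    then show ?thesis by simp
  next
    case False
    with p[of "sign_change {i} y"] p[of y] show ?thesis
      by (simp add: partial_sign_change[OF f ev] sign_change_nth)
  qed
  then have "even_in i (\<lambda>y. 1/4 * q y)" by (simp add: even_in_def)
  moreover have "smooth (\<lambda>y. 1/4 * q y)" by (intro smooth_mult smooth_const q)
  ultimately show ?thesis using p by blast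
qed

text \<open>The operator \<open>E\<close> of the overview. Choosing a smooth solution avoids an
  explicit formula on the hyperplane \<open>x $ i = 0\<close>, where the quotient would be a
  limit.\<close>

definition half_quotient :: "'n \<Rightarrow> (real ^ 'n::finite \<Rightarrow> complex) \<Rightarrow> real ^ 'n \<Rightarrow> complex" where
  "half_quotient i f = (SOME e. smooth e \<and> even_in i e \<and>
     (\<forall>x. partial i f x = 2 * complex_of_real (x $ i) * e x))"

lemma half_quotient:
  assumes "smooth f" "even_in i f"
  shows "smooth (half_quotient i f)" "even_in i (half_quotient i f)"
    "partial i f x = 2 * complex_of_real (x $ i) * half_quotient i f x"
  using someI_ex[OF half_quotient_exists[OF assms]] unfolding half_quotient_def by blast+

text \<open>\<open>f\<close> serves the side \<open>x $ i > 0\<close> without modification.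
  \<open>F\<close> serves the other side, where the arguments
  \<open>2 ^ k * sqrt (- (x $ i))\<close> grow with \<open>k\<close> and bounded support is wanted.
  Agreement near the hyperplane makes the two sides fit together.\<close>

definition truncation :: "'n \<Rightarrow> (real ^ 'n::finite \<Rightarrow> complex) \<Rightarrow> (real ^ 'n \<Rightarrow> complex) \<Rightarrow> bool" where
  "truncation i f F \<longleftrightarrow> smooth f \<and> smooth F \<and> even_in i f \<and> even_in i F \<and>
     (\<forall>x. \<bar>x $ i\<bar> < 1 \<longrightarrow> f x = F x) \<and> (\<forall>x. 2 < \<bar>x $ i\<bar> \<longrightarrow> F x = 0)"

lemma open_nth_abs: "open {x::real^'n::finite. \<bar>x $ i\<bar> < a}" "open {x::real^'n::finite. a < \<bar>x $ i\<bar>}"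
  by (intro open_Collect_less continuous_intros)+

lemma partial_truncation:
  assumes "truncation i f F"
  shows "\<bar>x $ i\<bar> < 1 \<Longrightarrow> partial j f x = partial j F x" "2 < \<bar>x $ i\<bar> \<Longrightarrow> partial j F x = 0"
proof -
  show "partial j f x = partial j F x" if "\<bar>x $ i\<bar> < 1"
    by (rule partial_cong_open[OF open_nth_abs(1)[of i 1]]) (use that assms in \<open>auto simp: truncation_def\<close>)
  have "partial j F x = partial j (\<lambda>x. 0) x" if "2 < \<bar>x $ i\<bar>"
    by (rule partial_cong_open[OF open_nth_abs(2)[of 2 i]]) (use that assms in \<open>auto simp: truncation_def\<close>)
  then show "partial j F x = 0" if "2 < \<bar>x $ i\<bar>" using that by (simp add: partial_const)
qed

lemma truncation_partial:
  assumes "truncation i f F" "j \<noteq> i"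
  shows "truncation i (partial j f) (partial j F)"
  using assms partial_truncation[OF assms(1)] unfolding truncation_def
  by (auto simp: even_in_def[of i "partial j f"] even_in_def[of i "partial j F"] partial_sign_change intro: smooth_partial)

text \<open>Agreement and vanishing follow by dividing the partials by \<open>x $ i\<close>; on the
  hyperplane itself agreement follows by continuity. Stability of the relation is what permits
  induction on the order of differentiation.\<close>

lemma truncation_half_quotient:
  assumes t: "truncation i f F"
  shows "truncation i (half_quotient i f) (half_quotient i F)"
proof -
  have f: "smooth f" "even_in i f" and F: "smooth F" "even_in i F" using t by (auto simp: truncation_def)
  note hf = half_quotient[OF f] and hF = half_quotient[OF F]
  have nz: "half_quotient i f x = half_quotient i F x" if "\<bar>x $ i\<bar> < 1" "x $ i \<noteq> 0" for x
    using partial_truncation(1)[OF t that(1), of i] hf(3)[of x] hF(3)[of x] that by simp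
  have "half_quotient i f x = half_quotient i F x" if "\<bar>x $ i\<bar> < 1" for x
  proof (cases "x $ i = 0")
    case True
    let ?d = "\<lambda>s. half_quotient i f (put i x s) - half_quotient i F (put i x s)"
    have "continuous_on UNIV ?d"
      by (intro continuous_intros continuous_on_smooth[OF hf(1)] continuous_on_smooth[OF hF(1)])
    then have "(?d \<longlongrightarrow> ?d 0) (at 0)" by (simp add: continuous_on_def)
    moreover have "eventually (\<lambda>s. ?d s = 0) (at (0::real))"
      unfolding eventually_at by (rule exI[of _ 1]) (auto intro!: nz)
    then have "(?d \<longlongrightarrow> 0) (at 0)"
      by (rule tendsto_eventually)
    ultimately have "?d 0 = 0" by (rule tendsto_unique[rotated]) simp
    moreover have "put i x 0 = x" using put_same[of i x] True by simp
    ultimately show ?thesis by simp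
  qed (use nz that in auto)
  moreover have "half_quotient i F x = 0" if "2 < \<bar>x $ i\<bar>" for x
    using partial_truncation(2)[OF t that, of i] hF(3)[of x] that by auto
  ultimately show ?thesis using hf hF by (auto simp: truncation_def)
qed

section \<open>Extension across the hyperplane\<close>

locale extension_weights =
  fixes c :: "nat \<Rightarrow> real"
  assumes summable_c: "\<And>m. summable (\<lambda>k. \<bar>c k * (- (4 ^ k)) ^ m\<bar>)"
    and sum_c: "\<And>m. (\<Sum>k. c k * (- (4 ^ k)) ^ m) = 1"
begin

text \<open>\<open>m\<close> counts the derivatives taken in the coordinate being extended: each one
  brings out \<open>- (4 ^ k)\<close> from the \<open>k\<close>-th term.\<close>

definition weight :: "nat \<Rightarrow> nat \<Rightarrow> complex" where
  "weight m k = complex_of_real (c k * (- (4 ^ k)) ^ m)"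

lemma sum_weight: "(\<Sum>k. weight m k * z) = z"
proof -
  have "(\<lambda>k. c k * (- (4 ^ k)) ^ m) sums 1"
    using summable_sums[OF summable_rabs_cancel[OF summable_c[of m]]] sum_c[of m] by simp
  from sums_mult2[OF sums_of_real[OF this, where 'a=complex], of z]
  show ?thesis by (simp add: weight_def sums_unique[symmetric])
qed

lemma weight_Suc: "weight (Suc m) k = - complex_of_real (4 ^ k) * weight m k"
  by (simp add: weight_def)

text \<open>The extension proper is the case \<open>m = 0\<close>; larger \<open>m\<close> describe
  its derivatives. At \<open>x $ i = 0\<close> every term contains the same value of
  \<open>F\<close>, and the moment condition makes the series equal to it, for every
  \<open>m\<close>.\<close>

definition extend :: "'n \<Rightarrow> nat \<Rightarrow> (real ^ 'n::finite \<Rightarrow> complex) \<Rightarrow> (real ^ 'n \<Rightarrow> complex) \<Rightarrow> real ^ 'n \<Rightarrow> complex" where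
  "extend i m f F x = (if x $ i \<le> 0 then \<Sum>k. weight m k * F (put i x (2 ^ k * sqrt (- (x $ i))))
     else f (put i x (sqrt (x $ i))))"

lemma extend_nonneg:
  assumes "truncation i f F" "0 \<le> x $ i"
  shows "extend i m f F x = f (put i x (sqrt (x $ i)))"
  using assms by (auto simp: extend_def sum_weight truncation_def)

text \<open>Off the hyperplane the support of \<open>F\<close> leaves a finite sum. A single
  \<open>K\<close> serves a whole neighbourhood, so differentiation term by term needs no uniform
  convergence.\<close>

lemma extend_neg:
  assumes "truncation i f F" "x $ i < 0" "2 < 2 ^ K * sqrt (- (x $ i))"
  shows "extend i m f F x = (\<Sum>k<K. weight m k * F (put i x (2 ^ k * sqrt (- (x $ i)))))"
proof -
  have "F (put i x (2 ^ k * sqrt (- (x $ i)))) = 0" if "k \<notin> {..<K}" for k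
  proof -
    have "2 ^ K * sqrt (- (x $ i)) \<le> 2 ^ k * sqrt (- (x $ i))"
      by (rule mult_right_mono) (use that assms in \<open>auto intro: power_increasing\<close>)
    with assms(3) have "2 < \<bar>put i x (2 ^ k * sqrt (- (x $ i))) $ i\<bar>"
      unfolding put_nth_same by linarith
    with assms(1) show ?thesis unfolding truncation_def by blast
  qed
  then have "(\<Sum>k. weight m k * F (put i x (2 ^ k * sqrt (- (x $ i))))) =
      (\<Sum>k<K. weight m k * F (put i x (2 ^ k * sqrt (- (x $ i)))))"
    by (intro suminf_finite) auto
  with assms show ?thesis by (simp add: extend_def)
qed

lemma exists_scale: "0 < s \<Longrightarrow> \<exists>K. 2 < 2 ^ K * (s::real)"
  using real_arch_pow[of 2 "2 / s"] by (auto simp: field_simps)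

text \<open>Near the hyperplane the number of nonzero terms is unbounded, so the M-test is used:
  \<open>F\<close> is bounded over a ball of base points, by compactness for arguments in
  \<open>{-2..2}\<close> and by vanishing beyond, and the weights are absolutely summable.\<close>

lemma continuous_on_extend_series:
  assumes t: "truncation i f F"
  shows "continuous_on {x. x $ i \<le> 0} (\<lambda>x. \<Sum>k. weight m k * F (put i x (2 ^ k * sqrt (- (x $ i)))))"
    (is "continuous_on ?A ?S")
proof -
  have F: "smooth F" using t by (simp add: truncation_def)
  have "continuous (at x0 within ?A) ?S" if x0: "x0 \<in> ?A" for x0
  proof -
    let ?B = "?A \<inter> ball x0 1"
    have "compact ((\<lambda>p. F (put i (fst p) (snd p))) ` (cball x0 1 \<times> {-2..2}))"
      by (intro compact_continuous_image compact_Times continuous_on_smooth[OF F] continuous_intros) auto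
    from compact_imp_bounded[OF this]
    obtain B where "\<forall>y \<in> (\<lambda>p. F (put i (fst p) (snd p))) ` (cball x0 1 \<times> {-2..2}). norm y \<le> B"
      unfolding bounded_iff by blast
    then have B: "norm (F (put i x s)) \<le> B" if "x \<in> cball x0 1" "s \<in> {-2..2}" for x s
    proof -
      have "(x, s) \<in> cball x0 1 \<times> {-2..2}" using that by simp
      from bspec[OF \<open>\<forall>y \<in> _. norm y \<le> B\<close> imageI[OF this]] show ?thesis by (simp only: fst_conv snd_conv)
    qed
    have B0: "0 \<le> B" using order_trans[OF norm_ge_zero B[of x0 0]] by simp
    have bd: "norm (F (put i x s)) \<le> B" if "x \<in> ?B" for x s
    proof (cases "\<bar>s\<bar> \<le> 2")
      case True
      then show ?thesis using that by (intro B) auto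
    next
      case False
      then show ?thesis using t B0 by (simp add: truncation_def)
    qed
    have "uniform_limit ?B (\<lambda>n x. \<Sum>k<n. weight m k * F (put i x (2 ^ k * sqrt (- (x $ i))))) ?S sequentially"
    proof (rule Weierstrass_m_test)
      show "norm (weight m k * F (put i x (2 ^ k * sqrt (- (x $ i))))) \<le> \<bar>c k * (- (4 ^ k)) ^ m\<bar> * B" if "x \<in> ?B" for k x
        unfolding norm_mult weight_def norm_of_real by (intro mult_left_mono bd that) auto
      show "summable (\<lambda>k. \<bar>c k * (- (4 ^ k)) ^ m\<bar> * B)"
        by (intro summable_mult2 summable_c)
    qed
    then have "continuous_on ?B ?S"
      by (rule uniform_limit_theorem[rotated])
         (auto intro!: always_eventually continuous_intros continuous_on_smooth[OF F])
    then have "continuous (at x0 within ?B) ?S"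
      using x0 by (simp add: continuous_on_eq_continuous_within)
    moreover have "at x0 within ?B = at x0 within ?A"
      by (rule at_within_nhd[of _ "ball x0 1"]) auto
    ultimately show ?thesis by simp
  qed
  then show ?thesis by (simp add: continuous_on_eq_continuous_within)
qed

lemma continuous_on_extend:
  assumes t: "truncation i f F"
  shows "continuous_on UNIV (extend i m f F)"
proof -
  have f: "smooth f" using t by (simp add: truncation_def)
  have "continuous_on UNIV (\<lambda>x. if x $ i \<le> 0 then \<Sum>k. weight m k * F (put i x (2 ^ k * sqrt (- (x $ i))))
     else f (put i x (sqrt (x $ i))))"
  proof (rule continuous_on_cases_le)
    show "continuous_on {x \<in> UNIV. x $ i \<le> 0} (\<lambda>x. \<Sum>k. weight m k * F (put i x (2 ^ k * sqrt (- (x $ i)))))"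
      using continuous_on_extend_series[OF t] by simp
    show "continuous_on {x \<in> UNIV. 0 \<le> x $ i} (\<lambda>x. f (put i x (sqrt (x $ i))))"
      by (intro continuous_on_smooth[OF f] continuous_intros)
    show "continuous_on UNIV (\<lambda>x::real^'a. x $ i)" by (intro continuous_intros)
  qed (use t in \<open>auto simp: sum_weight truncation_def\<close>)
  also have "(\<lambda>x. if x $ i \<le> 0 then \<Sum>k. weight m k * F (put i x (2 ^ k * sqrt (- (x $ i))))
     else f (put i x (sqrt (x $ i)))) = extend i m f F"
    by (auto simp: extend_def)
  finally show ?thesis .
qed

text \<open>Moving in coordinate \<open>j\<close> keeps \<open>x $ i\<close> fixed, so the whole
  line stays in one branch. Points on the hyperplane belong to the branch of \<open>f\<close> by
  \<open>extend_nonneg\<close>.\<close>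

lemma extend_partial_other:
  assumes t: "truncation i f F" and j: "j \<noteq> i"
  shows "((\<lambda>s. extend i m f F (x + s *\<^sub>R axis j 1)) has_vector_derivative
           extend i m (partial j f) (partial j F) x) (at 0)"
proof -
  note t' = truncation_partial[OF t j]
  have f: "smooth f" and F: "smooth F" using t by (auto simp: truncation_def)
  have xi: "(x + s *\<^sub>R axis j 1) $ i = x $ i" for s using j by (simp add: axis_def)
  show ?thesis
  proof (cases "0 \<le> x $ i")
    case True
    have "((\<lambda>s. f (put i x (sqrt (x $ i)) + s *\<^sub>R axis j 1)) has_vector_derivative
        partial j f (put i x (sqrt (x $ i)))) (at 0)"
      by (rule has_partial[OF smooth_differentiable[OF f]])
    then show ?thesis
      using True xi by (simp only: extend_nonneg[OF t] extend_nonneg[OF t'] put_add_other[OF j])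
  next
    case False
    then have neg: "x $ i < 0" by simp
    then obtain K where K: "2 < 2 ^ K * sqrt (- (x $ i))" using exists_scale[of "sqrt (- (x $ i))"] by auto
    have "((\<lambda>s. \<Sum>k<K. weight m k * F (put i x (2 ^ k * sqrt (- (x $ i))) + s *\<^sub>R axis j 1)) has_vector_derivative
        (\<Sum>k<K. weight m k * partial j F (put i x (2 ^ k * sqrt (- (x $ i)))))) (at 0)"
      by (intro has_vector_derivative_sum has_vector_derivative_mult_right has_partial smooth_differentiable F)
    then show ?thesis
      using neg K xi by (simp only: extend_neg[OF t, where K=K] extend_neg[OF t', where K=K] put_add_other[OF j])
  qed
qed

lemma put_partial:
  assumes "smooth f"
  shows "((\<lambda>s. f (put i x s)) has_vector_derivative partial i f (put i x s)) (at s)"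
proof -
  have "((\<lambda>t. f (put i x s + t *\<^sub>R axis i 1)) has_vector_derivative partial i f (put i x s)) (at (s - s))"
    using has_partial[OF smooth_differentiable[OF assms], of "put i x s" i] by simp
  then have "((\<lambda>t. f (put i x s + t *\<^sub>R axis i 1)) \<circ> (\<lambda>t. t - s) has_vector_derivative 1 *\<^sub>R partial i f (put i x s)) (at s)"
    by (intro vector_diff_chain_at) (auto intro!: derivative_eq_intros)
  then show ?thesis by (simp add: o_def flip: put_add)
qed

lemma put_compose_deriv:
  assumes "smooth f" "even_in i f" "(u has_real_derivative u') (at s)"
  shows "((\<lambda>s. f (put i x (u s))) has_vector_derivative
      complex_of_real (2 * u' * u s) * half_quotient i f (put i x (u s))) (at s)"
proof -
  have "(u has_vector_derivative u') (at s)"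
    using assms(3) by (simp add: has_real_derivative_iff_has_vector_derivative)
  from vector_diff_chain_at[OF this put_partial[OF assms(1), of i x]]
  show ?thesis
    by (simp add: o_def half_quotient(3)[OF assms(1,2)] scaleR_conv_of_real[where 'a=complex] mult_ac)
qed

text \<open>The derivative of \<open>f\<close> at \<open>sqrt s\<close> is the half quotient at
  \<open>sqrt s\<close>; that of the \<open>k\<close>-th term on the negative side has the
  additional factor \<open>- (4 ^ k)\<close>, which raises \<open>m\<close> by one.\<close>

lemma extend_put_deriv_nonzero:
  assumes t: "truncation i f F" and s: "s \<noteq> 0"
  shows "((\<lambda>s. extend i m f F (put i x s)) has_vector_derivative
           extend i (Suc m) (half_quotient i f) (half_quotient i F) (put i x s)) (at s)"
proof -
  note t' = truncation_half_quotient[OF t]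
  have f: "smooth f" "even_in i f" and F: "smooth F" "even_in i F" using t by (auto simp: truncation_def)
  show ?thesis
  proof (cases "0 < s")
    case True
    have "(sqrt has_real_derivative inverse (sqrt s) / 2) (at s)"
      using True by (rule DERIV_real_sqrt)
    from put_compose_deriv[OF f this, of x]
    have D: "((\<lambda>s. f (put i x (sqrt s))) has_vector_derivative half_quotient i f (put i x (sqrt s))) (at s)"
      using True by simp
    have "((\<lambda>s. extend i m f F (put i x s)) has_vector_derivative half_quotient i f (put i x (sqrt s))) (at s)"
      by (rule has_vector_derivative_transform_within_open[OF D, of "{0<..}"])
         (use True in \<open>auto simp: extend_nonneg[OF t]\<close>)
    with True show ?thesis by (simp add: extend_nonneg[OF t'])
  next
    case False
    with s have neg: "s < 0" by simp
    \<comment> \<open>Choosing \<open>K\<close> for \<open>s / 2\<close> makes the same finite sum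
      valid for all \<open>r < s / 2\<close>, an open set containing \<open>s\<close>.\<close>
    then obtain K where K: "2 < 2 ^ K * sqrt (- (s / 2))" using exists_scale[of "sqrt (- (s / 2))"] by auto
    have K': "2 < 2 ^ K * sqrt (- r)" if "r < s / 2" for r
    proof -
      have "2 ^ K * sqrt (- (s / 2)) \<le> 2 ^ K * sqrt (- r)" using that by simp
      with K show ?thesis by linarith
    qed
    have d: "((\<lambda>s. F (put i x (2 ^ k * sqrt (- s)))) has_vector_derivative
        - complex_of_real (4 ^ k) * half_quotient i F (put i x (2 ^ k * sqrt (- s)))) (at s)" for k
    proof -
      have "((\<lambda>s. 2 ^ k * sqrt (- s)) has_real_derivative 2 ^ k * (- (inverse (sqrt (- s)) / 2))) (at s)"
        using neg by (auto intro!: derivative_eq_intros)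
      from put_compose_deriv[OF F this, of x] show ?thesis
        using neg by (simp add: field_simps flip: power_mult_distrib)
    qed
    have D: "((\<lambda>s. \<Sum>k<K. weight m k * F (put i x (2 ^ k * sqrt (- s)))) has_vector_derivative
       (\<Sum>k<K. weight m k * (- complex_of_real (4 ^ k) * half_quotient i F (put i x (2 ^ k * sqrt (- s)))))) (at s)"
      by (intro has_vector_derivative_sum has_vector_derivative_mult_right d)
    have "((\<lambda>s. extend i m f F (put i x s)) has_vector_derivative
       (\<Sum>k<K. weight m k * (- complex_of_real (4 ^ k) * half_quotient i F (put i x (2 ^ k * sqrt (- s)))))) (at s)"
      by (rule has_vector_derivative_transform_within_open[OF D, of "{..<s / 2}"])
         (use neg K' in \<open>auto simp: extend_neg[OF t, where K=K]\<close>)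
    also have "(\<Sum>k<K. weight m k * (- complex_of_real (4 ^ k) * half_quotient i F (put i x (2 ^ k * sqrt (- s)))))
        = extend i (Suc m) (half_quotient i f) (half_quotient i F) (put i x s)"
      using neg K'[of s] by (simp add: extend_neg[OF t', where K=K] weight_Suc mult_ac)
    finally show ?thesis .
  qed
qed

text \<open>At 0 the two one-sided formulas are not differentiated directly. The function is
  continuous and has the continuous candidate as derivative off 0, so the fundamental theorem with
  one exceptional point writes it as an integral of the candidate, which is differentiable at 0
  too.\<close>

lemma extend_partial_same:
  assumes t: "truncation i f F"
  shows "((\<lambda>s. extend i m f F (x + s *\<^sub>R axis i 1)) has_vector_derivative
           extend i (Suc m) (half_quotient i f) (half_quotient i F) x) (at 0)"
proof -
  let ?\<phi> = "\<lambda>s. extend i m f F (put i x s)"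
  let ?\<psi> = "\<lambda>s. extend i (Suc m) (half_quotient i f) (half_quotient i F) (put i x s)"
  have c: "continuous_on UNIV ?\<phi>" "continuous_on UNIV ?\<psi>"
    by (auto intro!: continuous_intros continuous_on_compose2[OF continuous_on_extend[OF t]]
        continuous_on_compose2[OF continuous_on_extend[OF truncation_half_quotient[OF t]]])
  have D: "(?\<phi> has_vector_derivative ?\<psi> s) (at s)" for s
  proof (cases "s = 0")
    case True
    have I: "(?\<psi> has_integral (?\<phi> u - ?\<phi> (-1))) {-1..u}" if "-1 \<le> u" for u
      by (rule fundamental_theorem_of_calculus_interior_strong[of "{0}"])
         (use that extend_put_deriv_nonzero[OF t] in \<open>auto intro: continuous_on_subset[OF c(1)]\<close>)
    have "((\<lambda>u. integral {-1..u} ?\<psi>) has_vector_derivative ?\<psi> 0) (at 0 within {-1..1})"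
      by (rule integral_has_vector_derivative) (auto intro: continuous_on_subset[OF c(2)])
    then have "((\<lambda>u. ?\<phi> (-1) + integral {-1..u} ?\<psi>) has_vector_derivative ?\<psi> 0) (at 0 within {-1..1})"
      by (auto intro!: derivative_eq_intros)
    then have H: "((\<lambda>u. ?\<phi> (-1) + integral {-1..u} ?\<psi>) has_vector_derivative ?\<psi> 0) (at 0)"
      by (simp add: at_within_Icc_at)
    have E: "?\<phi> (-1) + integral {-1..u} ?\<psi> = ?\<phi> u" if "u \<in> {-1<..<1}" for u
      using integral_unique[OF I[of u]] that by simp
    have "(?\<phi> has_vector_derivative ?\<psi> 0) (at 0)"
      by (rule has_vector_derivative_transform_within_open[OF H, of "{-1<..<1}"]) (simp_all add: E)
    with True show ?thesis by simp
  qed (rule extend_put_deriv_nonzero[OF t])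
  have "(?\<phi> \<circ> (\<lambda>s. x $ i + s) has_vector_derivative 1 *\<^sub>R ?\<psi> (x $ i)) (at 0)"
    using D[of "x $ i"] by (intro vector_diff_chain_at) (auto intro!: derivative_eq_intros)
  then show ?thesis by (simp add: o_def put_add)
qed

text \<open>Every partial of an extension is the extension of another truncation pair, possibly with
  larger \<open>m\<close>. Hence the induction on the order keeps \<open>m\<close>, \<open>f\<close>
  and \<open>F\<close> arbitrary.\<close>

lemma smooth_extend:
  assumes "truncation i f F"
  shows "smooth (extend i m f F)"
proof -
  have "diffN n (extend i m f F)" if "truncation i f F" for n m f F
    using that
  proof (induction n arbitrary: m f F)
    case (Suc n)
    let ?g = "\<lambda>j. if j = i then extend i (Suc m) (half_quotient i f) (half_quotient i F)
       else extend i m (partial j f) (partial j F)"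
    show ?case
    proof (rule diffN_SucI)
      show "((\<lambda>s. extend i m f F (x + s *\<^sub>R axis j 1)) has_vector_derivative ?g j x) (at 0)" for j x
        using extend_partial_same[OF Suc.prems] extend_partial_other[OF Suc.prems] by simp
      show "continuous_on UNIV (?g j)" for j
        using Suc.prems by (simp add: continuous_on_extend truncation_partial truncation_half_quotient)
      show "diffN n (?g j)" for j
        using Suc.prems by (simp add: Suc.IH truncation_partial truncation_half_quotient)
    qed
  qed simp
  with assms show ?thesis by (simp add: smooth_iff_diffN)
qed

lemma extend_even_other:
  assumes "j \<noteq> i" "even_in j f" "even_in j F"
  shows "even_in j (extend i m f F)"
proof -
  have "put i (sign_change {j} x) s = sign_change {j} (put i x s)" for x s
    using assms(1) by (auto simp: vec_eq_iff put_nth sign_change_nth)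
  moreover have "sign_change {j} x $ i = x $ i" for x :: "real^'a"
    using assms(1) by (simp add: sign_change_nth)
  ultimately show ?thesis using assms by (simp add: even_in_def extend_def)
qed

end

section \<open>From one coordinate to all squares\<close>

text \<open>Only values at \<open>(x $ i)^2\<close>, hence on the nonnegative side, matter for the
  equation. There the extension is \<open>f\<close> at the absolute value of \<open>x $ i\<close>,
  which evenness replaces by \<open>x $ i\<close>. Parity in the other coordinates is inherited so
  that the construction can be repeated.\<close>

lemma smooth_even_in_imp_square:
  fixes f :: "real ^ 'n::finite \<Rightarrow> complex"
  assumes f: "smooth f" "even_in i f"
  obtains g where "smooth g" "\<And>x. f x = g (put i x ((x $ i)\<^sup>2))"
    "\<And>j. j \<noteq> i \<Longrightarrow> even_in j f \<Longrightarrow> even_in j g"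
proof -
  obtain c :: "nat \<Rightarrow> real" where "extension_weights c"
    using extension_weights_exist by (metis extension_weights.intro)
  then interpret extension_weights c .
  obtain \<theta> :: "real ^ 'n \<Rightarrow> complex" where \<theta>: "smooth \<theta>" "\<And>x. \<bar>x $ i\<bar> < 1 \<Longrightarrow> \<theta> x = 1"
    "\<And>x. 2 < \<bar>x $ i\<bar> \<Longrightarrow> \<theta> x = 0" "\<And>x y. \<bar>x $ i\<bar> = \<bar>y $ i\<bar> \<Longrightarrow> \<theta> x = \<theta> y"
    using smooth_cutoff by blast
  let ?F = "\<lambda>x. f x * \<theta> x"
  have \<theta>s: "\<theta> (sign_change {j} x) = \<theta> x" for j x
    by (rule \<theta>(4)) (simp add: sign_change_nth)
  have evF: "even_in j ?F" if "even_in j f" for j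
    using that by (simp add: even_in_def \<theta>s)
  have t: "truncation i f ?F"
    unfolding truncation_def using f \<theta>(2,3) by (auto intro: smooth_mult \<theta>(1) evF)
  show ?thesis
  proof (rule that)
    show "smooth (extend i 0 f ?F)" by (rule smooth_extend[OF t])
    show "f x = extend i 0 f ?F (put i x ((x $ i)\<^sup>2))" for x
      using even_in_abs[OF f(2), of x "x $ i"] by (simp add: extend_nonneg[OF t])
    show "even_in j (extend i 0 f ?F)" if "j \<noteq> i" "even_in j f" for j
      using that evF by (intro extend_even_other)
  qed
qed

text \<open>\<open>S\<close> collects the coordinates already replaced by their squares; the
  invariant is that \<open>g\<close> is still even in all the others.\<close>

lemma smooth_even_imp_squares:
  fixes f :: "real ^ 'n::finite \<Rightarrow> complex"
  assumes f: "smooth f" "\<And>j. even_in j f" and "finite S"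
  shows "\<exists>g. smooth g \<and> (\<forall>x. f x = g (\<chi> l. if l \<in> S then (x $ l)\<^sup>2 else x $ l)) \<and> (\<forall>j. j \<notin> S \<longrightarrow> even_in j g)"
  using assms(3)
proof (induction S)
  case empty
  have "(\<chi> l. x $ l) = x" for x :: "real^'n" by (simp add: vec_eq_iff)
  with f show ?case by auto
next
  case (insert i S)
  then obtain g where g: "smooth g" "\<And>x. f x = g (\<chi> l. if l \<in> S then (x $ l)\<^sup>2 else x $ l)"
    "\<And>j. j \<notin> S \<Longrightarrow> even_in j g" by blast
  obtain h where h: "smooth h" "\<And>x. g x = h (put i x ((x $ i)\<^sup>2))"
    "\<And>j. j \<noteq> i \<Longrightarrow> even_in j g \<Longrightarrow> even_in j h"
    using smooth_even_in_imp_square[OF g(1) g(3)[OF insert.hyps(2)]] by metis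
  have "put i (\<chi> l. if l \<in> S then (x $ l)\<^sup>2 else x $ l) (((\<chi> l. if l \<in> S then (x $ l)\<^sup>2 else x $ l) $ i)\<^sup>2) =
     (\<chi> l. if l \<in> insert i S then (x $ l)\<^sup>2 else x $ l)" for x
    using insert.hyps(2) by (auto simp: vec_eq_iff put_nth)
  then have "f x = h (\<chi> l. if l \<in> insert i S then (x $ l)\<^sup>2 else x $ l)" for x
    using g(2) h(2) by simp
  with h g show ?case by (intro exI[of _ h]) auto
qed

lemma whitney_even:
  fixes f :: "real ^ 'n::finite \<Rightarrow> complex"
  assumes "smooth f" "Z2n_invariant f"
  obtains f0 where "smooth f0" "\<And>x. f x = f0 (sqv x)"
proof -
  have "even_in j f" for j using assms(2) by (simp add: Z2n_invariant_def even_in_def)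
  with smooth_even_imp_squares[OF assms(1), of UNIV] show ?thesis
    by (auto simp: sqv_def intro: that)
qed

theorem theorem5p7:
  fixes k :: real and \<nu> :: complex and f :: "real ^ 'n::{finite,linorder} \<Rightarrow> complex"
  defines "\<mu>0 \<equiv> k * (real CARD('n) - 1)"
  assumes k_nonneg: "k \<ge> 0"
    and nu: "Re \<nu> > \<mu>0 + 1/2"
    and f_smooth: "smooth f"
    and f_inv: "Z2n_invariant f"
  shows "(\<exists>f0. smooth f0 \<and> (\<forall>x. f x = f0 (sqv x)))
       \<and> (\<forall>f0. smooth f0 \<and> (\<forall>x. f x = f0 (sqv x)) \<longrightarrow>
            (\<forall>x. Delta x \<noteq> 0 \<longrightarrow>
               (let k' = \<nu> - complex_of_real \<mu>0 - 1/2
                in DeltaOp (dunklB k k') (DeltaOp (dunklB k k') f) x)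
               = L_op k \<nu> f0 (sqv x)))"
proof (intro conjI allI impI)
  show "\<exists>f0. smooth f0 \<and> (\<forall>x. f x = f0 (sqv x))"
    using whitney_even[OF f_smooth f_inv] by metis
next
  fix f0 :: "real ^ 'n::{finite,linorder} \<Rightarrow> complex" and x :: "real ^ 'n::{finite,linorder}"
  assume "smooth f0 \<and> (\<forall>x. f x = f0 (sqv x))" and x: "Delta x \<noteq> 0"
  then have f0: "smooth f0" and "f = (\<lambda>x. f0 (sqv x))" by auto
  with DeltaOp_dunklB_squared[OF f0 x, of k \<nu>]
  show "(let k' = \<nu> - complex_of_real \<mu>0 - 1/2
          in DeltaOp (dunklB k k') (DeltaOp (dunklB k k') f) x) = L_op k \<nu> f0 (sqv x)"
    by (simp add: \<mu>0_def Let_def)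
qed

end
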